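(* Let $(M,g)=(B\times_f F,\ g_B+f^2g_F)$ be a warped product manifold with $m_1=\dim B$, let $(\overline{M},\overline{g})=(\overline{M}(c),\overline{g},J)$ be a complex space form of constant holomorphic sectional curvature $c$, and let $\psi:(M,g)\to(\overline{M},\overline{g})$ be an isometric immersion. Assume that $(M,g)$ is a totally geodesic totally real submanifold of $(\overline{M},\overline{g})$ (i.e., $J(TM)\subset TM^{\perp}$). Then $$m_1\frac{c}{4}\ \le\ \frac{\triangle f}{f}\ \le\ m_1\frac{c}{4}.$$
   Context: $(B,g_B)$ and $(F,g_F)$ are Riemannian manifolds (of positive dimension), $f:B\to\mathbb{R}^+$ is a smooth positive function (the warping function), and $B\times_f F$ is the product $B\times F$ with the metric $g=g_B+f^2g_F$; $f$ is also regarded as a function on $M$ via the projection to $B$. All dimensions are real. The Laplacian is $\triangle f=\sum_i\big((\nabla_{v_i}v_i)f-v_i^2f\big)$ for a local orthonormal frame $\{v_i\}$ of $TM$, where $\nabla$ is the Levi-Civita connection of $M$ (note the sign). Totally geodesic means that the second fundamental form of the immersion vanishes identically; $TM^\perp$ is the normal bundle. A complex space form $(\overline{M}(c),\overline{g},J)$ is a Kähler manifold of constant holomorphic sectional curvature $c$; its curvature tensor is $$\overline{R}(X,Y)Z=\tfrac{c}{4}\big(\overline{g}(Y,Z)X-\overline{g}(X,Z)Y+\overline{g}(JY,Z)JX-\overline{g}(JX,Z)JY-2\overline{g}(JX,Y)JZ\big).$$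
   Formalization: Here △f is the Laplacian of f on the base (B,g_B), not of its lift to M as the given definition literally says; with the Laplacian of M the claim fails, e.g. for (0,∞)×_r S¹ = R²∖{0} in C², where c=0 but △f/f = −1/r². *)

theory Defs
  imports "HOL-Analysis.Analysis"
begin

abbreviation D ::
  "('a::real_normed_vector \<Rightarrow> 'b::real_normed_vector) \<Rightarrow> 'a \<Rightarrow> 'a \<Rightarrow> 'b" where
  "D h x u \<equiv> frechet_derivative h (at x) u"

text \<open>Class \<open>C\<^sup>k\<close>, via iterated directional derivatives. Only used for open \<open>S\<close> and with a
  finite-dimensional domain.\<close>

primrec Ck_on ::
  "nat \<Rightarrow> 'a::real_normed_vector set \<Rightarrow> ('a \<Rightarrow> 'b::real_normed_vector) \<Rightarrow> bool" where
  "Ck_on 0 S h \<longleftrightarrow> continuous_on S h"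
| "Ck_on (Suc k) S h \<longleftrightarrow> (\<forall>x\<in>S. h differentiable (at x)) \<and> (\<forall>u. Ck_on k S (\<lambda>x. D h x u))"

definition smooth_on :: "'a::real_normed_vector set \<Rightarrow> ('a \<Rightarrow> 'b::real_normed_vector) \<Rightarrow> bool" where
  "smooth_on S h \<longleftrightarrow> (\<forall>k. Ck_on k S h)"

text \<open>An atlas is an indexed family of charts, modelled on the Euclidean space \<open>'e\<close>. The manifold is
  the union of the chart domains, an open subset of the Hausdorff second countable space \<open>'a\<close>; its
  dimension is \<open>DIM('e)\<close>, which is positive by the class axioms.\<close>

record ('i, 'a, 'e) atlas =
  charts :: "'i set"
  chart_dom :: "'i \<Rightarrow> 'a set"
  coord :: "'i \<Rightarrow> 'a \<Rightarrow> 'e"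

definition points :: "('i, 'a, 'e) atlas \<Rightarrow> 'a set" where
  "points M = (\<Union>i\<in>charts M. chart_dom M i)"

definition chart_img :: "('i, 'a, 'e) atlas \<Rightarrow> 'i \<Rightarrow> 'e set" where
  "chart_img M i = coord M i ` chart_dom M i"

definition param :: "('i, 'a, 'e) atlas \<Rightarrow> 'i \<Rightarrow> 'e \<Rightarrow> 'a" where
  "param M i = inv_into (chart_dom M i) (coord M i)"

definition transition :: "('i, 'a, 'e) atlas \<Rightarrow> 'i \<Rightarrow> 'i \<Rightarrow> 'e \<Rightarrow> 'e" where
  "transition M i j = coord M j \<circ> param M i"

definition smooth_manifold ::
  "('i, 'a::{t2_space,second_countable_topology}, 'e::euclidean_space) atlas \<Rightarrow> bool" where
  "smooth_manifold M \<longleftrightarrow>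
     (\<forall>i\<in>charts M. open (chart_dom M i) \<and> open (chart_img M i) \<and>
        homeomorphism (chart_dom M i) (chart_img M i) (coord M i) (param M i)) \<and>
     (\<forall>i\<in>charts M. \<forall>j\<in>charts M.
        smooth_on (coord M i ` (chart_dom M i \<inter> chart_dom M j)) (transition M i j))"

definition smooth_function :: "('i, 'a, 'e::euclidean_space) atlas \<Rightarrow> ('a \<Rightarrow> real) \<Rightarrow> bool" where
  "smooth_function M f \<longleftrightarrow> (\<forall>i\<in>charts M. smooth_on (chart_img M i) (f \<circ> param M i))"

definition local_rep ::
  "('i, 'a, 'e) atlas \<Rightarrow> 'i \<Rightarrow> ('j, 'b, 'd) atlas \<Rightarrow> 'j \<Rightarrow> ('a \<Rightarrow> 'b) \<Rightarrow> 'e \<Rightarrow> 'd" where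
  "local_rep M i N j \<psi> = coord N j \<circ> \<psi> \<circ> param M i"

definition smooth_map ::
  "('i, 'a::topological_space, 'e::euclidean_space) atlas \<Rightarrow>
   ('j, 'b::topological_space, 'd::euclidean_space) atlas \<Rightarrow> ('a \<Rightarrow> 'b) \<Rightarrow> bool" where
  "smooth_map M N \<psi> \<longleftrightarrow> \<psi> ` points M \<subseteq> points N \<and> continuous_on (points M) \<psi> \<and>
     (\<forall>i\<in>charts M. \<forall>j\<in>charts N.
        smooth_on (coord M i ` {p \<in> chart_dom M i. \<psi> p \<in> chart_dom N j}) (local_rep M i N j \<psi>))"

text \<open>Tensor fields are given by their components in the charts of the atlas, subject to the
  transformation law: \<open>g i x u v\<close> is the inner product, at the point with coordinates \<open>x\<close> in chart
  \<open>i\<close>, of the tangent vectors with components \<open>u\<close> and \<open>v\<close> in that chart.\<close>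

type_synonym 'e metric = "'e \<Rightarrow> 'e \<Rightarrow> 'e \<Rightarrow> real"

definition riemannian_metric ::
  "('i, 'a::topological_space, 'e::euclidean_space) atlas \<Rightarrow> ('i \<Rightarrow> 'e metric) \<Rightarrow> bool" where
  "riemannian_metric M g \<longleftrightarrow>
     (\<forall>i\<in>charts M.
        (\<forall>x\<in>chart_img M i. bilinear (g i x) \<and> (\<forall>u v. g i x u v = g i x v u) \<and>
           (\<forall>u. u \<noteq> 0 \<longrightarrow> g i x u u > 0)) \<and>
        (\<forall>u v. smooth_on (chart_img M i) (\<lambda>x. g i x u v))) \<and>
     (\<forall>i\<in>charts M. \<forall>j\<in>charts M. \<forall>p \<in> chart_dom M i \<inter> chart_dom M j. \<forall>u v.
        g i (coord M i p) u v =
        g j (coord M j p) (D (transition M i j) (coord M i p) u)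
                          (D (transition M i j) (coord M i p) v))"

definition riemannian_manifold ::
  "('i, 'a::{t2_space,second_countable_topology}, 'e::euclidean_space) atlas \<Rightarrow>
   ('i \<Rightarrow> 'e metric) \<Rightarrow> bool" where
  "riemannian_manifold M g \<longleftrightarrow> smooth_manifold M \<and> riemannian_metric M g"

text \<open>The Koszul formula for coordinate fields, that is, the vector with components
  \<open>\<Gamma>\<^sup>k\<^sub>i\<^sub>j u\<^sup>i v\<^sup>j\<close>.\<close>

definition christoffel :: "'e::euclidean_space metric \<Rightarrow> 'e \<Rightarrow> 'e \<Rightarrow> 'e \<Rightarrow> 'e" where
  "christoffel G x u v = (THE w. \<forall>z. 2 * G x w z =
     D (\<lambda>y. G y v z) x u + D (\<lambda>y. G y u z) x v - D (\<lambda>y. G y u v) x z)"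

text \<open>\<open>\<nabla>\<^sub>X V\<close> for a vector field \<open>V\<close> along the map \<open>h\<close>, with respect to the Levi-Civita
  connection of the metric \<open>G\<close> on the target.\<close>

definition cov_along ::
  "'d::euclidean_space metric \<Rightarrow> ('e::euclidean_space \<Rightarrow> 'd) \<Rightarrow> ('e \<Rightarrow> 'e) \<Rightarrow> ('e \<Rightarrow> 'd) \<Rightarrow> 'e \<Rightarrow> 'd" where
  "cov_along G h X V x = D V x (X x) + christoffel G (h x) (D h x (X x)) (V x)"

definition cov ::
  "'e::euclidean_space metric \<Rightarrow> ('e \<Rightarrow> 'e) \<Rightarrow> ('e \<Rightarrow> 'e) \<Rightarrow> 'e \<Rightarrow> 'e" where
  "cov G X Y x = D Y x (X x) + christoffel G x (X x) (Y x)"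

text \<open>\<open>R(u,v)w = \<nabla>\<^sub>u\<nabla>\<^sub>v w - \<nabla>\<^sub>v\<nabla>\<^sub>u w - \<nabla>\<^bsub>[u,v]\<^esub> w\<close>, evaluated on the constant-coefficient extensions
  of \<open>u\<close>, \<open>v\<close>, \<open>w\<close> in the chart, whose brackets vanish.\<close>

definition riemann :: "'e::euclidean_space metric \<Rightarrow> 'e \<Rightarrow> 'e \<Rightarrow> 'e \<Rightarrow> 'e \<Rightarrow> 'e" where
  "riemann G x u v w =
     cov G (\<lambda>_. u) (cov G (\<lambda>_. v) (\<lambda>_. w)) x - cov G (\<lambda>_. v) (cov G (\<lambda>_. u) (\<lambda>_. w)) x"

definition sectional_curvature :: "'e::euclidean_space metric \<Rightarrow> 'e \<Rightarrow> 'e \<Rightarrow> 'e \<Rightarrow> real" where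
  "sectional_curvature G x u v =
     G x (riemann G x u v v) u / (G x u u * G x v v - (G x u v)\<^sup>2)"

definition orthonormal_frame_on ::
  "'e::euclidean_space metric \<Rightarrow> 'e set \<Rightarrow> ('e \<Rightarrow> 'e \<Rightarrow> 'e) \<Rightarrow> bool" where
  "orthonormal_frame_on G S v \<longleftrightarrow>
     (\<forall>b\<in>Basis. smooth_on S (v b)) \<and>
     (\<forall>x\<in>S. \<forall>b\<in>Basis. \<forall>b'\<in>Basis. G x (v b x) (v b' x) = (if b = b' then 1 else 0))"

text \<open>\<open>\<Sum>\<^sub>b ((\<nabla>\<^bsub>v b\<^esub> v b) h - v b (v b h))\<close>: the frame is indexed by \<open>Basis\<close> only to have \<open>DIM('e)\<close>
  members.\<close>

definition frame_laplacian ::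
  "'e::euclidean_space metric \<Rightarrow> ('e \<Rightarrow> 'e \<Rightarrow> 'e) \<Rightarrow> ('e \<Rightarrow> real) \<Rightarrow> 'e \<Rightarrow> real" where
  "frame_laplacian G v h x =
     (\<Sum>b\<in>Basis. D h x (cov G (v b) (v b) x) - D (\<lambda>y. D h y (v b y)) x (v b x))"

text \<open>The value does not depend on the chart and the local frame, so any choice will do. Note the
  sign: on flat space this is minus the sum of the second partial derivatives.\<close>

definition laplacian ::
  "('i, 'a, 'e::euclidean_space) atlas \<Rightarrow> ('i \<Rightarrow> 'e metric) \<Rightarrow> ('a \<Rightarrow> real) \<Rightarrow> 'a \<Rightarrow> real" where
  "laplacian M g f p = (SOME L. \<exists>i\<in>charts M. p \<in> chart_dom M i \<and>
     (\<exists>S v. open S \<and> coord M i p \<in> S \<and> S \<subseteq> chart_img M i \<and> orthonormal_frame_on (g i) S v \<and>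
        L = frame_laplacian (g i) v (f \<circ> param M i) (coord M i p)))"

definition prod_atlas ::
  "('i, 'a, 'e) atlas \<Rightarrow> ('j, 'b, 'd) atlas \<Rightarrow> ('i \<times> 'j, 'a \<times> 'b, 'e \<times> 'd) atlas" where
  "prod_atlas B F =
     \<lparr> charts = charts B \<times> charts F,
       chart_dom = (\<lambda>(i, j). chart_dom B i \<times> chart_dom F j),
       coord = (\<lambda>(i, j). map_prod (coord B i) (coord F j)) \<rparr>"

definition warped_metric ::
  "('i, 'a, 'e) atlas \<Rightarrow> ('i \<Rightarrow> 'e metric) \<Rightarrow> ('a \<Rightarrow> real) \<Rightarrow> ('j \<Rightarrow> 'd metric) \<Rightarrow>
   'i \<times> 'j \<Rightarrow> ('e \<times> 'd) metric" where
  "warped_metric B gB f gF = (\<lambda>(i, j) (x, y) u v.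
     gB i x (fst u) (fst v) + (f (param B i x))\<^sup>2 * gF j y (snd u) (snd v))"

definition almost_complex_structure ::
  "('i, 'a, 'e::euclidean_space) atlas \<Rightarrow> ('i \<Rightarrow> 'e \<Rightarrow> 'e \<Rightarrow> 'e) \<Rightarrow> bool" where
  "almost_complex_structure N J \<longleftrightarrow>
     (\<forall>i\<in>charts N.
        (\<forall>x\<in>chart_img N i. linear (J i x) \<and> (\<forall>u. J i x (J i x u) = - u)) \<and>
        (\<forall>u. smooth_on (chart_img N i) (\<lambda>x. J i x u))) \<and>
     (\<forall>i\<in>charts N. \<forall>j\<in>charts N. \<forall>p \<in> chart_dom N i \<inter> chart_dom N j. \<forall>u.
        D (transition N i j) (coord N i p) (J i (coord N i p) u) =
        J j (coord N j p) (D (transition N i j) (coord N i p) u))"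

text \<open>Almost Hermitian with \<open>\<nabla>J = 0\<close> (no integrability needs to be assumed).\<close>

definition kaehler_manifold ::
  "('i, 'a::{t2_space,second_countable_topology}, 'e::euclidean_space) atlas \<Rightarrow>
   ('i \<Rightarrow> 'e metric) \<Rightarrow> ('i \<Rightarrow> 'e \<Rightarrow> 'e \<Rightarrow> 'e) \<Rightarrow> bool" where
  "kaehler_manifold N g J \<longleftrightarrow> riemannian_manifold N g \<and> almost_complex_structure N J \<and>
     (\<forall>i\<in>charts N. \<forall>x\<in>chart_img N i.
        (\<forall>u v. g i x (J i x u) (J i x v) = g i x u v) \<and>
        (\<forall>X Y. smooth_on (chart_img N i) X \<and> smooth_on (chart_img N i) Y \<longrightarrow>
           cov (g i) X (\<lambda>y. J i y (Y y)) x = J i x (cov (g i) X Y x)))"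

definition complex_space_form ::
  "('i, 'a::{t2_space,second_countable_topology}, 'e::euclidean_space) atlas \<Rightarrow>
   ('i \<Rightarrow> 'e metric) \<Rightarrow> ('i \<Rightarrow> 'e \<Rightarrow> 'e \<Rightarrow> 'e) \<Rightarrow> real \<Rightarrow> bool" where
  "complex_space_form N g J c \<longleftrightarrow> kaehler_manifold N g J \<and>
     (\<forall>i\<in>charts N. \<forall>x\<in>chart_img N i. \<forall>u. u \<noteq> 0 \<longrightarrow> sectional_curvature (g i) x u (J i x u) = c)"

definition isometric_immersion ::
  "('i, 'a::topological_space, 'e::euclidean_space) atlas \<Rightarrow> ('i \<Rightarrow> 'e metric) \<Rightarrow>
   ('j, 'b::topological_space, 'd::euclidean_space) atlas \<Rightarrow> ('j \<Rightarrow> 'd metric) \<Rightarrow>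
   ('a \<Rightarrow> 'b) \<Rightarrow> bool" where
  "isometric_immersion M g N gN \<psi> \<longleftrightarrow> smooth_map M N \<psi> \<and>
     (\<forall>i\<in>charts M. \<forall>j\<in>charts N. \<forall>p\<in>chart_dom M i. \<psi> p \<in> chart_dom N j \<longrightarrow>
        (let x = coord M i p; h = local_rep M i N j \<psi>
         in inj (D h x) \<and> (\<forall>u v. gN j (h x) (D h x u) (D h x v) = g i x u v)))"

text \<open>Gauss formula \<open>II(u,v) = \<nabla>\<^sup>N\<^sub>u (d\<psi> v) - d\<psi> (\<nabla>\<^sup>M\<^sub>u v)\<close>, in the chart \<open>i\<close> of \<open>M\<close> and the chart
  \<open>j\<close> of \<open>N\<close>, with \<open>u\<close>, \<open>v\<close> extended with constant coefficients (the expression is tensorial).\<close>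

definition second_fundamental_form ::
  "('i, 'a, 'e::euclidean_space) atlas \<Rightarrow> ('i \<Rightarrow> 'e metric) \<Rightarrow>
   ('j, 'b, 'd::euclidean_space) atlas \<Rightarrow> ('j \<Rightarrow> 'd metric) \<Rightarrow> ('a \<Rightarrow> 'b) \<Rightarrow>
   'i \<Rightarrow> 'j \<Rightarrow> 'a \<Rightarrow> 'e \<Rightarrow> 'e \<Rightarrow> 'd" where
  "second_fundamental_form M g N gN \<psi> i j p u v =
     (let x = coord M i p; h = local_rep M i N j \<psi>
      in cov_along (gN j) h (\<lambda>_. u) (\<lambda>y. D h y v) x - D h x (cov (g i) (\<lambda>_. u) (\<lambda>_. v) x))"

definition totally_geodesic ::
  "('i, 'a, 'e::euclidean_space) atlas \<Rightarrow> ('i \<Rightarrow> 'e metric) \<Rightarrow>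
   ('j, 'b, 'd::euclidean_space) atlas \<Rightarrow> ('j \<Rightarrow> 'd metric) \<Rightarrow> ('a \<Rightarrow> 'b) \<Rightarrow> bool" where
  "totally_geodesic M g N gN \<psi> \<longleftrightarrow>
     (\<forall>i\<in>charts M. \<forall>j\<in>charts N. \<forall>p\<in>chart_dom M i. \<psi> p \<in> chart_dom N j \<longrightarrow>
        (\<forall>u v. second_fundamental_form M g N gN \<psi> i j p u v = 0))"

definition totally_real ::
  "('i, 'a, 'e::euclidean_space) atlas \<Rightarrow>
   ('j, 'b, 'd::euclidean_space) atlas \<Rightarrow> ('j \<Rightarrow> 'd metric) \<Rightarrow> ('j \<Rightarrow> 'd \<Rightarrow> 'd \<Rightarrow> 'd) \<Rightarrow>
   ('a \<Rightarrow> 'b) \<Rightarrow> bool" where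
  "totally_real M N gN J \<psi> \<longleftrightarrow>
     (\<forall>i\<in>charts M. \<forall>j\<in>charts N. \<forall>p\<in>chart_dom M i. \<psi> p \<in> chart_dom N j \<longrightarrow>
        (let x = coord M i p; h = local_rep M i N j \<psi>
         in \<forall>u v. gN j (h x) (J j (h x) (D h x u)) (D h x v) = 0))"

end

theory Submission
  imports Defs
begin

text \<open>Polarization shows that constant holomorphic curvature \<open>c\<close> forces sectional curvature \<open>c / 4\<close>
  on totally real planes. For \<open>X\<close> tangent to the base and \<open>U\<close> tangent to the fibre, commuting the
  covariant derivatives of \<open>d\<psi> X\<close> along the totally geodesic immersion gives
  \<open>R(U,X)X = - (Hess f (X,X) / f) U\<close>. Hence \<open>Hess f = - (c / 4) f g\<^sub>B\<close>, and the trace over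
  a Gram-Schmidt frame of the base is the claim.\<close>

subsection \<open>Calculus of smooth functions\<close>

text \<open>The two bounds are the same number, so the claim is an equation at each point. The
  curvature of the warped product is never computed, and no Gauss equation for curvatures is
  invoked: the two orders of differentiating \<open>d\<psi> X\<close> take values in the target,
  their difference is the ambient curvature, and of the warped metric only the Christoffel symbols
  in base-base and mixed directions enter. A vertical \<open>U\<close> is essential because the
  planes spanned by \<open>X\<close> and \<open>U\<close> are the ones whose curvature,
  \<open>- Hess f (X,X) / (f |X|^2)\<close>, involves the warping function in this simple way; total
  reality turns the hypothesis on holomorphic planes into a statement about them. Two features of
  the encoding shape the rest. Tensors are functions of a point and of fixed component vectors, so
  every differentiation of a field inserted into a tensor needs a product rule for moving arguments.
  And \<open>laplacian\<close> is a choice over charts and local frames, so the equation has to be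
  established for all of them.\<close>

lemma D_eqI: "(h has_derivative h') (at x) \<Longrightarrow> D h x u = h' u"
  by (simp add: frechet_derivative_at[symmetric])

text \<open>Functions that agree near \<open>x\<close> have the same derivatives there, so the
  choice made by \<open>frechet_derivative\<close> returns the same map, differentiable or
  not.\<close>

lemma D_cong:
  assumes "open S" "x \<in> S" "\<And>y. y \<in> S \<Longrightarrow> h y = k y"
  shows "frechet_derivative h (at x) = frechet_derivative k (at x)"
proof -
  have "(h has_derivative h') (at x) = (k has_derivative h') (at x)" for h'
    using has_derivative_transform_within_open[of h h' x UNIV S k]
      has_derivative_transform_within_open[of k h' x UNIV S h] assms by auto
  then show ?thesis
    unfolding frechet_derivative_def by simp
qed

lemma differentiable_cong_open:
  assumes "open S" "x \<in> S" "\<And>y. y \<in> S \<Longrightarrow> h y = k y" "h differentiable (at x)"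
  shows "k differentiable (at x)"
  using assms has_derivative_transform_within_open[of h _ x UNIV S k]
  unfolding differentiable_def by blast

lemma D_linear:
  assumes "h differentiable (at x)"
  shows "D h x (u + v) = D h x u + D h x v" "D h x (r *\<^sub>R u) = r *\<^sub>R D h x u"
    "D h x 0 = 0"
  using linear_frechet_derivative[OF assms]
  by (simp_all add: linear_add linear_scale linear_0)

section \<open>Closure properties of the classes \<open>Ck_on\<close> and
  \<open>smooth_on\<close>\<close>

lemma Ck_on_cong:
  assumes "open S" "\<And>x. x \<in> S \<Longrightarrow> h x = k x"
  shows "Ck_on n S h \<longleftrightarrow> Ck_on n S k"
  using assms(2)
proof (induction n arbitrary: h k)
  case 0
  then show ?case by (simp cong: continuous_on_cong)
next
  case (Suc n)
  have d: "frechet_derivative h (at x) = frechet_derivative k (at x)" if "x \<in> S" for x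
    using D_cong[OF assms(1) that] Suc.prems by blast
  have "Ck_on n S (\<lambda>x. D h x u) = Ck_on n S (\<lambda>x. D k x u)" for u
    by (rule Suc.IH) (simp add: d)
  moreover have "h differentiable (at x) \<longleftrightarrow> k differentiable (at x)" if "x \<in> S" for x
    using differentiable_cong_open[OF assms(1) that, of h k]
      differentiable_cong_open[OF assms(1) that, of k h] Suc.prems by auto
  ultimately show ?case by simp
qed

lemma Ck_on_SucD: "Ck_on (Suc n) S h \<Longrightarrow> Ck_on n S h"
proof (induction n arbitrary: h)
  case 0
  then show ?case
    by (auto intro!: continuous_at_imp_continuous_on differentiable_imp_continuous_within)
qed auto

lemma Ck_on_const: "Ck_on n S (\<lambda>x. c)"
  by (induction n arbitrary: c) auto

lemma Ck_on_ident: "Ck_on n S (\<lambda>x. x)"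
  by (cases n) (auto simp: Ck_on_const)

lemma Ck_on_add:
  assumes "open S"
  shows "Ck_on n S h \<Longrightarrow> Ck_on n S k \<Longrightarrow> Ck_on n S (\<lambda>x. h x + k x)"
proof (induction n arbitrary: h k)
  case (Suc n)
  have "D (\<lambda>x. h x + k x) x u = D h x u + D k x u" if "x \<in> S" for x u
    using Suc.prems that
    by (intro D_eqI has_derivative_add) (auto simp: frechet_derivative_works[symmetric])
  then have "Ck_on n S (\<lambda>x. D (\<lambda>x. h x + k x) x u)" for u
    using Suc.IH[of "\<lambda>x. D h x u" "\<lambda>x. D k x u"] Suc.prems
      Ck_on_cong[OF assms, of "\<lambda>x. D (\<lambda>x. h x + k x) x u" "\<lambda>x. D h x u + D k x u"] by simp
  then show ?case
    using Suc.prems by auto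
qed (auto intro: continuous_on_add)

lemma Ck_on_bilinear:
  assumes "bounded_bilinear p" "open S"
  shows "Ck_on n S h \<Longrightarrow> Ck_on n S k \<Longrightarrow> Ck_on n S (\<lambda>x. p (h x) (k x))"
proof (induction n arbitrary: h k)
  case 0
  then show ?case by (simp add: bounded_bilinear.continuous_on[OF assms(1)])
next
  case (Suc n)
  have *: "((\<lambda>x. p (h x) (k x)) has_derivative (\<lambda>u. p (h x) (D k x u) + p (D h x u) (k x))) (at x)"
    if "x \<in> S" for x
    using Suc.prems that
    by (intro bounded_bilinear.FDERIV[OF assms(1)]) (auto simp: frechet_derivative_works[symmetric])
  have "Ck_on n S (\<lambda>x. D (\<lambda>x. p (h x) (k x)) x u)" for u
  proof -
    have "Ck_on n S (\<lambda>x. p (h x) (D k x u) + p (D h x u) (k x))"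
      by (intro Ck_on_add[OF assms(2)] Suc.IH) (use Suc.prems Ck_on_SucD in auto)
    then show ?thesis
      using Ck_on_cong[OF assms(2), of "\<lambda>x. D (\<lambda>x. p (h x) (k x)) x u"] D_eqI[OF *] by simp
  qed
  moreover have "\<forall>x\<in>S. (\<lambda>x. p (h x) (k x)) differentiable at x"
    using * differentiable_def by blast
  ultimately show ?case by simp
qed

lemma Ck_on_bounded_linear:
  assumes "bounded_linear L" "open S"
  shows "Ck_on n S h \<Longrightarrow> Ck_on n S (\<lambda>x. L (h x))"
proof (induction n arbitrary: h)
  case 0
  then show ?case by (simp add: bounded_linear.continuous_on[OF assms(1)])
next
  case (Suc n)
  have *: "((\<lambda>x. L (h x)) has_derivative (\<lambda>u. L (D h x u))) (at x)" if "x \<in> S" for x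
    using Suc.prems that
    by (intro bounded_linear.has_derivative[OF assms(1)]) (auto simp: frechet_derivative_works[symmetric])
  have "Ck_on n S (\<lambda>x. D (\<lambda>x. L (h x)) x u)" for u
    using Suc.IH[of "\<lambda>x. D h x u"] Suc.prems
      Ck_on_cong[OF assms(2), of "\<lambda>x. D (\<lambda>x. L (h x)) x u"] D_eqI[OF *] by simp
  moreover have "\<forall>x\<in>S. (\<lambda>x. L (h x)) differentiable at x"
    using * differentiable_def by blast
  ultimately show ?case by simp
qed

text \<open>Differentiation lowers the exponent by one, so the induction runs over all exponents
  \<open>r\<close> at once. The case needed later is \<open>r = - 1 / 2\<close>, which normalizes a
  vector in Gram-Schmidt.\<close>

lemma Ck_on_powr:
  fixes h :: "'a::real_normed_vector \<Rightarrow> real"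
  assumes "open S" "\<And>x. x \<in> S \<Longrightarrow> h x > 0"
  shows "Ck_on n S h \<Longrightarrow> Ck_on n S (\<lambda>x. h x powr r)"
proof (induction n arbitrary: r)
  case 0
  then show ?case using assms(2)
    by (auto intro!: continuous_on_powr continuous_on_const) (metis less_irrefl)
next
  case (Suc n)
  have *: "((\<lambda>x. h x powr r) has_derivative (\<lambda>u. (r * h x powr (r - 1)) * D h x u)) (at x)"
    if "x \<in> S" for x
  proof -
    have "(h has_derivative (\<lambda>u. D h x u)) (at x)"
      using Suc.prems that by (auto simp: frechet_derivative_works[symmetric])
    moreover have "((\<lambda>t. t powr r) has_derivative (\<lambda>t. (r * h x powr (r - 1)) * t)) (at (h x))"
      using has_real_derivative_powr[OF assms(2)[OF that], of r]
      by (simp add: has_field_derivative_def)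
    ultimately show ?thesis
      using diff_chain_at by (fastforce simp: o_def)
  qed
  have "Ck_on n S (\<lambda>x. D (\<lambda>x. h x powr r) x u)" for u
  proof -
    have "Ck_on n S (\<lambda>x. (r * h x powr (r - 1)) * D h x u)"
      using Suc Ck_on_SucD
      by (intro Ck_on_bilinear[OF bounded_bilinear_mult assms(1)] Ck_on_const) auto
    then show ?thesis
      using Ck_on_cong[OF assms(1), of "\<lambda>x. D (\<lambda>x. h x powr r) x u"] D_eqI[OF *] by simp
  qed
  moreover have "\<forall>x\<in>S. (\<lambda>x. h x powr r) differentiable at x"
    using * differentiable_def by blast
  ultimately show ?case by simp
qed

lemma smooth_on_cong:
  "open S \<Longrightarrow> (\<And>x. x \<in> S \<Longrightarrow> h x = k x) \<Longrightarrow> smooth_on S h \<longleftrightarrow> smooth_on S k"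
  unfolding smooth_on_def using Ck_on_cong by blast

lemma smooth_on_D: "smooth_on S h \<Longrightarrow> smooth_on S (\<lambda>x. D h x u)"
  unfolding smooth_on_def by (metis Ck_on.simps(2))

lemma smooth_on_differentiable: "smooth_on S h \<Longrightarrow> x \<in> S \<Longrightarrow> h differentiable (at x)"
  unfolding smooth_on_def by (metis Ck_on.simps(2))

lemma smooth_on_has_derivative:
  "smooth_on S h \<Longrightarrow> x \<in> S \<Longrightarrow> (h has_derivative (\<lambda>u. D h x u)) (at x)"
  using smooth_on_differentiable frechet_derivative_works by blast

lemma smooth_on_continuous_on: "smooth_on S h \<Longrightarrow> continuous_on S h"
  unfolding smooth_on_def by (metis Ck_on.simps(1))

lemma smooth_on_const: "smooth_on S (\<lambda>x. c)"
  by (simp add: smooth_on_def Ck_on_const)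

lemma smooth_on_ident: "smooth_on S (\<lambda>x. x)"
  by (simp add: smooth_on_def Ck_on_ident)

lemma smooth_on_add:
  "open S \<Longrightarrow> smooth_on S h \<Longrightarrow> smooth_on S k \<Longrightarrow> smooth_on S (\<lambda>x. h x + k x)"
  by (simp add: smooth_on_def Ck_on_add)

lemma smooth_on_sum:
  assumes "open S"
  shows "(\<And>i. i \<in> I \<Longrightarrow> smooth_on S (h i)) \<Longrightarrow> smooth_on S (\<lambda>x. \<Sum>i\<in>I. h i x)"
  by (induction I rule: infinite_finite_induct) (auto intro!: smooth_on_add assms smooth_on_const)

lemma smooth_on_mult:
  fixes h k :: "'a::real_normed_vector \<Rightarrow> real"
  shows "open S \<Longrightarrow> smooth_on S h \<Longrightarrow> smooth_on S k \<Longrightarrow> smooth_on S (\<lambda>x. h x * k x)"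
  by (simp add: smooth_on_def Ck_on_bilinear[OF bounded_bilinear_mult])

lemma smooth_on_scaleR:
  "open S \<Longrightarrow> smooth_on S h \<Longrightarrow> smooth_on S k \<Longrightarrow> smooth_on S (\<lambda>x. h x *\<^sub>R k x)"
  by (simp add: smooth_on_def Ck_on_bilinear[OF bounded_bilinear_scaleR])

lemma smooth_on_bounded_linear:
  "bounded_linear L \<Longrightarrow> open S \<Longrightarrow> smooth_on S h \<Longrightarrow> smooth_on S (\<lambda>x. L (h x))"
  by (simp add: smooth_on_def Ck_on_bounded_linear)

lemma smooth_on_diff:
  "open S \<Longrightarrow> smooth_on S h \<Longrightarrow> smooth_on S k \<Longrightarrow> smooth_on S (\<lambda>x. h x - k x)"
  using smooth_on_add[of S h "\<lambda>x. - k x"]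
    smooth_on_bounded_linear[OF bounded_linear_minus[OF bounded_linear_ident], of S k] by simp

lemma smooth_on_powr:
  fixes h :: "'a::real_normed_vector \<Rightarrow> real"
  shows "open S \<Longrightarrow> (\<And>x. x \<in> S \<Longrightarrow> h x > 0) \<Longrightarrow> smooth_on S h \<Longrightarrow> smooth_on S (\<lambda>x. h x powr r)"
  by (simp add: smooth_on_def Ck_on_powr)

section \<open>Product rules for tensors whose arguments move with the point\<close>

lemma has_derivative_linear_family:
  fixes T :: "'a::real_normed_vector \<Rightarrow> 'b::euclidean_space \<Rightarrow> 'c::real_normed_vector"
  assumes S: "open S" "x \<in> S" and T: "\<And>y. y \<in> S \<Longrightarrow> linear (T y)"
    and dT: "\<And>z. (\<lambda>y. T y z) differentiable (at x)" and s: "(s has_derivative s') (at x)"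
  shows "((\<lambda>y. T y (s y)) has_derivative (\<lambda>u. D (\<lambda>y. T y (s x)) x u + T x (s' u))) (at x)"
proof -
  \<comment> \<open>Expanding the argument in the standard basis separates the two dependences on
    \<open>y\<close>: what remains is a finite sum of products of a coordinate of \<open>s y\<close>
    with \<open>T y b\<close>, and \<open>b\<close> is constant. Smoothness of \<open>T\<close> for
    fixed arguments is therefore enough.\<close>
  have ex: "T y z = (\<Sum>b\<in>Basis. (z \<bullet> b) *\<^sub>R T y b)" if "y \<in> S" for y z
    using linear_sum[OF T[OF that]] linear_scale[OF T[OF that]] euclidean_representation[of z]
    by (metis (mono_tags, lifting) sum.cong)
  have d: "((\<lambda>y. T y z) has_derivative (\<lambda>u. D (\<lambda>y. T y z) x u)) (at x)" for z
    using dT frechet_derivative_works by blast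
  have "((\<lambda>y. \<Sum>b\<in>Basis. (s y \<bullet> b) *\<^sub>R T y b) has_derivative
      (\<lambda>u. \<Sum>b\<in>Basis. (s x \<bullet> b) *\<^sub>R D (\<lambda>y. T y b) x u + (s' u \<bullet> b) *\<^sub>R T x b)) (at x)"
    by (intro has_derivative_sum has_derivative_scaleR d has_derivative_inner_left s)
  then have 1: "((\<lambda>y. T y (s y)) has_derivative
      (\<lambda>u. \<Sum>b\<in>Basis. (s x \<bullet> b) *\<^sub>R D (\<lambda>y. T y b) x u + (s' u \<bullet> b) *\<^sub>R T x b)) (at x)"
    by (rule has_derivative_transform_within_open[OF _ S]) (use ex in metis)
  have "((\<lambda>y. \<Sum>b\<in>Basis. (s x \<bullet> b) *\<^sub>R T y b) has_derivative
      (\<lambda>u. \<Sum>b\<in>Basis. (s x \<bullet> b) *\<^sub>R D (\<lambda>y. T y b) x u)) (at x)"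
    by (intro has_derivative_sum has_derivative_scaleR_right d)
  then have "((\<lambda>y. T y (s x)) has_derivative
      (\<lambda>u. \<Sum>b\<in>Basis. (s x \<bullet> b) *\<^sub>R D (\<lambda>y. T y b) x u)) (at x)"
    by (rule has_derivative_transform_within_open[OF _ S]) (use ex in metis)
  from D_eqI[OF this] have "D (\<lambda>y. T y (s x)) x u + T x (s' u) =
      (\<Sum>b\<in>Basis. (s x \<bullet> b) *\<^sub>R D (\<lambda>y. T y b) x u + (s' u \<bullet> b) *\<^sub>R T x b)" for u
    using ex[OF S(2), of "s' u"] by (simp add: sum.distrib)
  then show ?thesis using 1 by presburger
qed

lemma smooth_on_linear_family:
  fixes T :: "'a::real_normed_vector \<Rightarrow> 'b::euclidean_space \<Rightarrow> 'c::real_normed_vector"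
  assumes S: "open S" and T: "\<And>y. y \<in> S \<Longrightarrow> linear (T y)"
    and dT: "\<And>z. smooth_on S (\<lambda>y. T y z)" and s: "smooth_on S s"
  shows "smooth_on S (\<lambda>y. T y (s y))"
proof -
  have ex: "T y z = (\<Sum>b\<in>Basis. (z \<bullet> b) *\<^sub>R T y b)" if "y \<in> S" for y z
    using linear_sum[OF T[OF that]] linear_scale[OF T[OF that]] euclidean_representation[of z]
    by (metis (mono_tags, lifting) sum.cong)
  have "smooth_on S (\<lambda>y. \<Sum>b\<in>Basis. (s y \<bullet> b) *\<^sub>R T y b)"
    by (intro smooth_on_sum smooth_on_scaleR S dT smooth_on_bounded_linear[OF bounded_linear_inner_left] s)
  then show ?thesis
    using smooth_on_cong[OF S, of "\<lambda>y. T y (s y)" "\<lambda>y. \<Sum>b\<in>Basis. (s y \<bullet> b) *\<^sub>R T y b"] ex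
    by blast
qed

lemma has_derivative_bilinear_family:
  fixes T :: "'a::real_normed_vector \<Rightarrow> 'b::euclidean_space \<Rightarrow> 'c::euclidean_space \<Rightarrow> 'd::real_normed_vector"
  assumes S: "open S" "x \<in> S" and T: "\<And>y. y \<in> S \<Longrightarrow> bilinear (T y)"
    and dT: "\<And>w z. (\<lambda>y. T y w z) differentiable (at x)"
    and s: "(s has_derivative s') (at x)" and t: "(t has_derivative t') (at x)"
  shows "((\<lambda>y. T y (s y) (t y)) has_derivative
    (\<lambda>u. D (\<lambda>y. T y (s x) (t x)) x u + T x (s' u) (t x) + T x (s x) (t' u))) (at x)"
proof -
  \<comment> \<open>One slot at a time: here only the second argument moves. The resulting family,
    linear in \<open>w\<close>, is then subjected to the same rule with \<open>w\<close>
    moving.\<close>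
  have 1: "((\<lambda>y. T y w (t y)) has_derivative
      (\<lambda>u. D (\<lambda>y. T y w (t x)) x u + T x w (t' u))) (at x)" for w
    by (rule has_derivative_linear_family[OF S _ dT t]) (use T in \<open>auto simp: bilinear_def\<close>)
  have "((\<lambda>y. T y (s y) (t y)) has_derivative
      (\<lambda>u. D (\<lambda>y. T y (s x) (t y)) x u + T x (s' u) (t x))) (at x)"
  proof (rule has_derivative_linear_family[where T = "\<lambda>y w. T y w (t y)", OF S _ _ s])
    show "linear (\<lambda>w. T y w (t y))" if "y \<in> S" for y
      using T[OF that] by (simp add: bilinear_def)
    show "(\<lambda>y. T y w (t y)) differentiable (at x)" for w
      using 1 differentiable_def by blast
  qed
  moreover have "D (\<lambda>y. T y (s x) (t y)) x u = D (\<lambda>y. T y (s x) (t x)) x u + T x (s x) (t' u)" for u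
    using D_eqI[OF 1] .
  ultimately show ?thesis by (simp add: algebra_simps)
qed

lemma smooth_on_bilinear_family:
  fixes T :: "'a::real_normed_vector \<Rightarrow> 'b::euclidean_space \<Rightarrow> 'c::euclidean_space \<Rightarrow> 'd::real_normed_vector"
  assumes S: "open S" and T: "\<And>y. y \<in> S \<Longrightarrow> bilinear (T y)"
    and dT: "\<And>w z. smooth_on S (\<lambda>y. T y w z)" and s: "smooth_on S s" and t: "smooth_on S t"
  shows "smooth_on S (\<lambda>y. T y (s y) (t y))"
proof (rule smooth_on_linear_family[where T = "\<lambda>y w. T y w (t y)", OF S _ _ s])
  show "linear (\<lambda>w. T y w (t y))" if "y \<in> S" for y
    using T[OF that] by (simp add: bilinear_def)
  show "smooth_on S (\<lambda>y. T y z (t y))" for z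
    by (rule smooth_on_linear_family[where T = "\<lambda>y. T y z", OF S _ dT t])
      (use T in \<open>simp add: bilinear_def\<close>)
qed

section \<open>Symmetry of second derivatives\<close>

lemma second_difference_limit:
  fixes h :: "'a::real_normed_vector \<Rightarrow> real"
  assumes S: "open S" "x \<in> S" and h: "smooth_on S h" and "e > 0"
  obtains d where "d > 0" and "\<And>s. 0 < s \<Longrightarrow> s < d \<Longrightarrow>
    \<bar>(h (x + s *\<^sub>R u + s *\<^sub>R v) - h (x + s *\<^sub>R u) - h (x + s *\<^sub>R v) + h x) / s\<^sup>2
      - D (\<lambda>y. D h y u) x v\<bar> < e"
proof -
  let ?k = "\<lambda>y. D (\<lambda>y. D h y u) y v"
  have hu: "smooth_on S (\<lambda>y. D h y u)" and "smooth_on S ?k"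
    by (intro smooth_on_D h)+
  then have "continuous_on S ?k"
    by (simp add: smooth_on_continuous_on)
  then have "continuous (at x) ?k"
    using S continuous_on_eq_continuous_at by blast
  then obtain d1 where d1: "d1 > 0" "\<And>y. dist y x < d1 \<Longrightarrow> \<bar>?k y - ?k x\<bar> < e"
    using \<open>e > 0\<close> unfolding continuous_at_eps_delta dist_real_def by blast
  obtain d2 where d2: "d2 > 0" "ball x d2 \<subseteq> S"
    using S openE by blast
  \<comment> \<open>The parallelogram with sides \<open>s u\<close> and \<open>s v\<close> lies
    within \<open>s * m\<close> of \<open>x\<close>; the summand 1 keeps \<open>m\<close> positive
    when both vectors vanish. Below \<open>d\<close> it stays in the ball inside \<open>S\<close>
    and where \<open>?k\<close> varies by less than \<open>e\<close>.\<close>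
  define m where "m = norm u + norm v + 1"
  have m: "m > 0" unfolding m_def by (simp add: add_nonneg_pos)
  define d where "d = min d1 d2 / m"
  show ?thesis
  proof
    show "d > 0" using d1 d2 m by (simp add: d_def)
    fix s :: real assume s: "0 < s" "s < d"
    have near: "dist (x + p *\<^sub>R u + q *\<^sub>R v) x < min d1 d2" if "0 \<le> p" "p \<le> s" "0 \<le> q" "q \<le> s" for p q
    proof -
      have "dist (x + p *\<^sub>R u + q *\<^sub>R v) x \<le> p * norm u + q * norm v"
        using that norm_triangle_ineq[of "p *\<^sub>R u" "q *\<^sub>R v"] by (simp add: dist_norm add.assoc)
      also have "\<dots> \<le> s * norm u + s * norm v"
        using that by (intro add_mono mult_right_mono) auto
      also have "\<dots> < s * m" using s by (simp add: m_def algebra_simps)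
      also have "\<dots> < d * m" using s m by simp
      also have "\<dots> = min d1 d2" using m by (simp add: d_def)
      finally show ?thesis .
    qed
    have inS: "x + p *\<^sub>R u + q *\<^sub>R v \<in> S" if "0 \<le> p" "p \<le> s" "0 \<le> q" "q \<le> s" for p q
      using near[OF that] d2 by (auto simp: dist_commute)
    have der1: "((\<lambda>t. h (x + t *\<^sub>R u + q *\<^sub>R v)) has_derivative
        (\<lambda>r. r * D h (x + p *\<^sub>R u + q *\<^sub>R v) u)) (at p)"
      if "0 \<le> p" "p \<le> s" "0 \<le> q" "q \<le> s" for p q
    proof -
      have "((\<lambda>t. x + t *\<^sub>R u + q *\<^sub>R v) has_derivative (\<lambda>r. r *\<^sub>R u)) (at p)"
        by (auto intro!: derivative_eq_intros)
      from diff_chain_at[OF this smooth_on_has_derivative[OF h inS[OF that]]]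
      show ?thesis
        using D_linear(2)[OF smooth_on_differentiable[OF h inS[OF that]]] by (simp add: o_def)
    qed
    have der2: "((\<lambda>t. D h (x + p *\<^sub>R u + t *\<^sub>R v) u) has_derivative
        (\<lambda>r. r * ?k (x + p *\<^sub>R u + q *\<^sub>R v))) (at q)"
      if "0 \<le> p" "p \<le> s" "0 \<le> q" "q \<le> s" for p q
    proof -
      have "((\<lambda>t. x + p *\<^sub>R u + t *\<^sub>R v) has_derivative (\<lambda>r. r *\<^sub>R v)) (at q)"
        by (auto intro!: derivative_eq_intros)
      from diff_chain_at[OF this smooth_on_has_derivative[OF hu inS[OF that]]]
      show ?thesis
        using D_linear(2)[OF smooth_on_differentiable[OF hu inS[OF that]]] by (simp add: o_def)
    qed
    \<comment> \<open>The second difference is the increment of \<open>?f\<close> over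
      \<open>{0..s}\<close>. One mean value in the \<open>u\<close> direction and one in the
      \<open>v\<close> direction turn it into exactly \<open>s^2\<close> times \<open>?k\<close> at
      an intermediate point. The idle \<open>0 *\<^sub>R v\<close> makes both sides of the
      parallelogram instances of \<open>der1\<close>.\<close>
    let ?f = "\<lambda>t. h (x + t *\<^sub>R u + s *\<^sub>R v) - h (x + t *\<^sub>R u + 0 *\<^sub>R v)"
    have "(?f has_derivative (\<lambda>r. r * D h (x + p *\<^sub>R u + s *\<^sub>R v) u - r * D h (x + p *\<^sub>R u + 0 *\<^sub>R v) u))
        (at p within {0..s})" if "0 \<le> p" "p \<le> s" for p
      using der1[OF that, of s] der1[OF that, of 0] s
      by (intro has_derivative_diff) (auto intro: has_derivative_at_withinI)
    from mvt_simple[OF s(1) this] obtain p where p: "0 < p" "p < s" and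
      fp: "?f s - ?f 0 = s * (D h (x + p *\<^sub>R u + s *\<^sub>R v) u - D h (x + p *\<^sub>R u + 0 *\<^sub>R v) u)"
      by (auto simp: algebra_simps)
    have "((\<lambda>t. D h (x + p *\<^sub>R u + t *\<^sub>R v) u) has_derivative (\<lambda>r. r * ?k (x + p *\<^sub>R u + q *\<^sub>R v)))
        (at q within {0..s})" if "0 \<le> q" "q \<le> s" for q
      using der2[of p q] that p by (auto intro: has_derivative_at_withinI)
    from mvt_simple[OF s(1) this] obtain q where q: "0 < q" "q < s" and
      fq: "D h (x + p *\<^sub>R u + s *\<^sub>R v) u - D h (x + p *\<^sub>R u + 0 *\<^sub>R v) u = s * ?k (x + p *\<^sub>R u + q *\<^sub>R v)"
      by auto
    have "(h (x + s *\<^sub>R u + s *\<^sub>R v) - h (x + s *\<^sub>R u) - h (x + s *\<^sub>R v) + h x) / s\<^sup>2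
        = ?k (x + p *\<^sub>R u + q *\<^sub>R v)"
      using fp s unfolding fq by (simp add: power2_eq_square field_simps)
    moreover have "\<bar>?k (x + p *\<^sub>R u + q *\<^sub>R v) - ?k x\<bar> < e"
      using near[of p q] p q by (intro d1) auto
    ultimately show "\<bar>(h (x + s *\<^sub>R u + s *\<^sub>R v) - h (x + s *\<^sub>R u) - h (x + s *\<^sub>R v) + h x) / s\<^sup>2
        - ?k x\<bar> < e" by simp
  qed
qed

text \<open>The second difference does not change when \<open>u\<close> and \<open>v\<close> are
  exchanged, so both mixed derivatives are limits of the same quotient. Half of their supposed gap
  serves as the tolerance.\<close>

lemma second_derivative_commute_real:
  fixes h :: "'a::real_normed_vector \<Rightarrow> real"
  assumes S: "open S" "x \<in> S" and h: "smooth_on S h"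
  shows "D (\<lambda>y. D h y u) x v = D (\<lambda>y. D h y v) x u"
proof (rule ccontr)
  let ?a = "D (\<lambda>y. D h y u) x v" and ?b = "D (\<lambda>y. D h y v) x u"
  assume "?a \<noteq> ?b"
  then have e: "\<bar>?a - ?b\<bar> / 2 > 0" by simp
  obtain d1 where d1: "d1 > 0" "\<And>s. 0 < s \<Longrightarrow> s < d1 \<Longrightarrow>
    \<bar>(h (x + s *\<^sub>R u + s *\<^sub>R v) - h (x + s *\<^sub>R u) - h (x + s *\<^sub>R v) + h x) / s\<^sup>2 - ?a\<bar> < \<bar>?a - ?b\<bar> / 2"
    using second_difference_limit[OF S h e] by blast
  obtain d2 where d2: "d2 > 0" "\<And>s. 0 < s \<Longrightarrow> s < d2 \<Longrightarrow>
    \<bar>(h (x + s *\<^sub>R v + s *\<^sub>R u) - h (x + s *\<^sub>R v) - h (x + s *\<^sub>R u) + h x) / s\<^sup>2 - ?b\<bar> < \<bar>?a - ?b\<bar> / 2"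
    using second_difference_limit[OF S h e] by blast
  define s where "s = min d1 d2 / 2"
  have s: "0 < s" "s < d1" "s < d2" using d1(1) d2(1) by (auto simp: s_def)
  have eq: "h (x + s *\<^sub>R v + s *\<^sub>R u) - h (x + s *\<^sub>R v) - h (x + s *\<^sub>R u) + h x
      = h (x + s *\<^sub>R u + s *\<^sub>R v) - h (x + s *\<^sub>R u) - h (x + s *\<^sub>R v) + h x"
    by (simp add: algebra_simps)
  have "False" if "\<bar>t - a\<bar> < \<bar>a - b\<bar> / 2" "\<bar>t - b\<bar> < \<bar>a - b\<bar> / 2" for t a b :: real
    using that by (simp add: abs_if field_simps split: if_splits)
  then show False
    using d1(2)[OF s(1,2)] d2(2)[OF s(1,3)] unfolding eq by blast
qed

lemma second_derivative_commute:
  fixes h :: "'a::real_normed_vector \<Rightarrow> 'b::euclidean_space"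
  assumes S: "open S" "x \<in> S" and h: "smooth_on S h"
  shows "D (\<lambda>y. D h y u) x v = D (\<lambda>y. D h y v) x u"
proof (rule euclidean_eqI)
  fix b :: 'b assume "b \<in> Basis"
  have D_inner: "D (\<lambda>y. k y \<bullet> b) y w = D k y w \<bullet> b" if "smooth_on S k" "y \<in> S"
    for k :: "'a \<Rightarrow> 'b" and y w
    by (rule D_eqI) (intro has_derivative_inner_left smooth_on_has_derivative[OF that])
  have "D (\<lambda>y. D (\<lambda>y. h y \<bullet> b) y p) x q = D (\<lambda>y. D h y p) x q \<bullet> b" for p q
  proof -
    have "D (\<lambda>y. D (\<lambda>y. h y \<bullet> b) y p) x q = D (\<lambda>y. D h y p \<bullet> b) x q"
      by (rule arg_cong[where f = "\<lambda>F. F q"], rule D_cong[OF S]) (simp add: D_inner[OF h])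
    also have "\<dots> = D (\<lambda>y. D h y p) x q \<bullet> b"
      by (rule D_inner[OF smooth_on_D[OF h] S(2)])
    finally show ?thesis .
  qed
  moreover have "D (\<lambda>y. D (\<lambda>y. h y \<bullet> b) y u) x v = D (\<lambda>y. D (\<lambda>y. h y \<bullet> b) y v) x u"
    by (intro second_derivative_commute_real[OF S] smooth_on_bounded_linear[OF bounded_linear_inner_left] S h)
  ultimately show "D (\<lambda>y. D h y u) x v \<bullet> b = D (\<lambda>y. D h y v) x u \<bullet> b" by simp
qed

subsection \<open>Constant holomorphic curvature\<close>

text \<open>Polarization: for fixed \<open>x\<close>, \<open>y\<close> set \<open>a = R(x,y,y,x)\<close> and \<open>b = R(x,Jy,Jy,x)\<close>. The part
  of \<open>Q(x + y)\<close> that is quadratic in both arguments is \<open>2 a + 6 b\<close>, and replacing \<open>y\<close> by \<open>Jy\<close>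
  exchanges \<open>a\<close> and \<open>b\<close>, so the two even parts determine \<open>a\<close>.\<close>

lemma holomorphic_polarization:
  fixes R :: "'a::real_vector \<Rightarrow> 'a \<Rightarrow> 'a \<Rightarrow> 'a \<Rightarrow> real" and J :: "'a \<Rightarrow> 'a"
  assumes lin1: "\<And>y z w. linear (\<lambda>x. R x y z w)" and lin3: "\<And>x y w. linear (\<lambda>z. R x y z w)"
    and skew12: "\<And>x y z w. R x y z w = - R y x z w"
    and skew34: "\<And>x y z w. R x y z w = - R x y w z"
    and bianchi: "\<And>x y z w. R x y z w + R y z x w + R z x y w = 0"
    and J: "linear J" "\<And>x. J (J x) = - x"
    and RJ: "\<And>x y z w. R x y (J z) (J w) = R x y z w"
  defines "Q \<equiv> \<lambda>x. R x (J x) (J x) x"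
  shows "32 * R x y y x =
    3 * Q (x + J y) + 3 * Q (x - J y) - Q (x + y) - Q (x - y) - 4 * Q x - 4 * Q y"
proof -
  have n1: "R (- x) y z w = - R x y z w" and a1: "R (x + x') y z w = R x y z w + R x' y z w"
    and d1: "R (x - x') y z w = R x y z w - R x' y z w" for x x' y z w
    by (rule linear_neg[OF lin1] linear_add[OF lin1] linear_diff[OF lin1])+
  have n3: "R x y (- z) w = - R x y z w" and a3: "R x y (z + z') w = R x y z w + R x y z' w"
    and d3: "R x y (z - z') w = R x y z w - R x y z' w" for z z' x y w
    by (rule linear_neg[OF lin3] linear_add[OF lin3] linear_diff[OF lin3])+
  have n2: "R x (- y) z w = - R x y z w" and a2: "R x (y + y') z w = R x y z w + R x y' z w"
    and d2: "R x (y - y') z w = R x y z w - R x y' z w" for y y' x z w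
    using n1 a1 d1 skew12[of x] by simp_all
  have n4: "R x y z (- w) = - R x y z w" and a4: "R x y z (w + w') = R x y z w + R x y z w'"
    and d4: "R x y z (w - w') = R x y z w - R x y z w'" for w w' x y z
    using n3 a3 d3 skew34[of x y z] by simp_all
  note neg = n1 n2 n3 n4
  note lin = neg a1 a2 a3 a4 d1 d2 d3 d4 linear_add[OF J(1)] linear_diff[OF J(1)] linear_neg[OF J(1)]
  \<comment> \<open>The octahedron argument: the four cyclic Bianchi sums, brought to common terms
    by the two skew symmetries, combine linearly to the pair symmetry.\<close>
  have pair: "R x y z w = R z w x y" for x y z w
    using bianchi[of x y z w] bianchi[of y z w x] bianchi[of z w x y] bianchi[of w x y z]
      skew12[of y z w x] skew34[of z y w x] skew12[of y z x w] skew34[of y z x w]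
      skew12[of z w y x] skew34[of z w y x] skew12[of w y z x] skew34[of w y z x]
      skew12[of w x z y] skew34[of w x z y] skew12[of x z w y] skew34[of x z w y]
      skew12[of x y w z] skew34[of x y w z] skew12[of z x y w] skew34[of z x y w]
      skew12[of w x y z] skew34[of w x y z] skew34[of y w x z] skew12[of y w x z]
    by linarith
  have RJ': "R (J x) (J y) z w = R x y z w" for x y z w
    using pair RJ by metis
  have even: "Q (x + y) + Q (x - y) = 2 * Q x + 2 * Q y + 4 * R x y y x + 12 * R x (J y) (J y) x"
    for x y
  proof -
    \<comment> \<open>Six terms of \<open>Q (x + y)\<close> are quadratic in both \<open>x\<close>
      and \<open>y\<close>. Facts 1 and 2 evaluate two of them to \<open>a + b\<close>; facts 3 to 5
      turn three others into \<open>b\<close>, and the last one is \<open>b\<close> itself. The sum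
      \<open>2 a + 6 b\<close> is doubled by adding \<open>Q (x - y)\<close>, which also removes the
      terms of odd degree in \<open>y\<close>.\<close>
    have 1: "R x (J x) (J y) y = R x y y x + R x (J y) (J y) x"
    proof -
      have "R x (J x) (J y) y = - R (J x) (J y) x y - R (J y) x (J x) y"
        using bianchi[of x "J x" "J y" y] by linarith
      moreover have "R (J x) (J y) x y = - R x y y x"
        using RJ' skew34 by metis
      moreover have "R (J y) x (J x) y = - R x (J y) (J y) x"
        using RJ[of "J y" x "J x" y] skew12[of "J y" x "J x" y] skew34[of x "J y" "J y" x]
        by (simp add: J neg) (metis add.inverse_inverse skew12)
      ultimately show ?thesis by simp
    qed
    have 2: "R y (J y) (J x) x = R x (J x) (J y) y"
      using pair[of y "J y" "J x" x] skew12[of "J x"] skew34[of x "J x" y] by simp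
    have 3: "R y (J x) (J x) y = R x (J y) (J y) x"
      using pair[of y "J x" "J x" y] RJ'[of "J x" y y "J x"] RJ[of x "J y" y "J x"]
        skew34[of x "J y" x "J y"] by (simp add: J neg)
    have 4: "R x (J y) (J x) y = R x (J y) (J y) x"
      using RJ[of x "J y" "J x" y] skew34[of x "J y" x "J y"] by (simp add: J neg)
    have 5: "R y (J x) (J y) x = R x (J y) (J y) x"
      using pair[of y "J x" "J y" x] skew12[of "J y" x] skew34[of x "J y" y "J x"] 4 by simp
    show ?thesis
      using 1 2 3 4 5 by (simp add: Q_def lin algebra_simps)
  qed
  have QJ: "Q (J y) = Q y"
    using RJ[of "J y" y y "J y"] skew12[of "J y" y] skew34[of y "J y" y "J y"]
    by (simp add: Q_def J neg)
  \<comment> \<open>With \<open>E y = Q (x + y) + Q (x - y)\<close>, the combination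
    \<open>3 E (J y) - E y\<close> eliminates \<open>b\<close>: its coefficient is
    \<open>3 * 4 - 12 = 0\<close>, and that of \<open>a\<close> is
    \<open>3 * 12 - 4 = 32\<close>.\<close>
  show ?thesis
    using even[of x y] even[of x "J y"] by (simp add: QJ J neg)
qed

text \<open>Total reality makes \<open>x\<close> and \<open>J y\<close> orthogonal, so
  \<open>x + J y\<close> and \<open>x - J y\<close> both have squared length
  \<open>G x x + G y y\<close>. The polarization formula then collapses to
  \<open>32 R x y y x = 8 c (G x x * G y y - (G x y)^2)\<close>, and \<open>8 / 32\<close> is the
  origin of \<open>c / 4\<close>.\<close>

lemma constant_holomorphic_curvature_totally_real:
  fixes R :: "'a::real_vector \<Rightarrow> 'a \<Rightarrow> 'a \<Rightarrow> 'a \<Rightarrow> real" and J :: "'a \<Rightarrow> 'a"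
    and G :: "'a \<Rightarrow> 'a \<Rightarrow> real"
  assumes "\<And>y z w. linear (\<lambda>x. R x y z w)" "\<And>x y w. linear (\<lambda>z. R x y z w)"
    and "\<And>x y z w. R x y z w = - R y x z w" "\<And>x y z w. R x y z w = - R x y w z"
    and "\<And>x y z w. R x y z w + R y z x w + R z x y w = 0"
    and J: "linear J" "\<And>x. J (J x) = - x"
    and "\<And>x y z w. R x y (J z) (J w) = R x y z w"
    and G: "bilinear G" "\<And>x y. G x y = G y x" "\<And>x y. G (J x) (J y) = G x y"
    and Q: "\<And>x. R x (J x) (J x) x = c * (G x x)\<^sup>2"
    and tr: "G (J y) x = 0"
  shows "R x y y x = c / 4 * (G x x * G y y - (G x y)\<^sup>2)"
proof -
  note pol = holomorphic_polarization[of R J x y, OF assms(1-8), unfolded Q]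
  have tr': "G x (J y) = 0"
    using tr G(2) by metis
  have lin: "G (x + y) z = G x z + G y z" "G (x - y) z = G x z - G y z"
      "G z (x + y) = G z x + G z y" "G z (x - y) = G z x - G z y" for x y z
    using G(1) by (simp_all add: bilinear_ladd bilinear_radd bilinear_lsub bilinear_rsub)
  show ?thesis
    using pol by (simp add: lin G tr tr' G(2)[of y x] power2_eq_square algebra_simps)
qed

subsection \<open>Metrics in a chart\<close>

lemma linear_D_linear_family:
  fixes T :: "'a::real_normed_vector \<Rightarrow> 'b::real_vector \<Rightarrow> 'c::real_normed_vector"
  assumes S: "open S" "x \<in> S" and T: "\<And>y. y \<in> S \<Longrightarrow> linear (T y)"
    and dT: "\<And>z. (\<lambda>y. T y z) differentiable (at x)"
  shows "linear (\<lambda>z. D (\<lambda>y. T y z) x u)"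
proof (rule linearI)
  have d: "((\<lambda>y. T y z) has_derivative (\<lambda>u. D (\<lambda>y. T y z) x u)) (at x)" for z
    using dT frechet_derivative_works by blast
  show "D (\<lambda>y. T y (a + b)) x u = D (\<lambda>y. T y a) x u + D (\<lambda>y. T y b) x u" for a b
  proof -
    have "D (\<lambda>y. T y (a + b)) x u = D (\<lambda>y. T y a + T y b) x u"
      by (rule fun_cong[OF D_cong[OF S]]) (simp add: linear_add T)
    then show ?thesis
      using D_eqI[OF has_derivative_add[OF d d]] by simp
  qed
  show "D (\<lambda>y. T y (r *\<^sub>R a)) x u = r *\<^sub>R D (\<lambda>y. T y a) x u" for r a
  proof -
    have "D (\<lambda>y. T y (r *\<^sub>R a)) x u = D (\<lambda>y. r *\<^sub>R T y a) x u"
      by (rule fun_cong[OF D_cong[OF S]]) (simp add: linear_scale T)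
    then show ?thesis
      using D_eqI[OF has_derivative_scaleR_right[OF d]] by simp
  qed
qed

lemma bilinear_D_bilinear_family:
  fixes T :: "'a::real_normed_vector \<Rightarrow> 'b::real_vector \<Rightarrow> 'c::real_vector \<Rightarrow> 'd::real_normed_vector"
  assumes S: "open S" "x \<in> S" and T: "\<And>y. y \<in> S \<Longrightarrow> bilinear (T y)"
    and dT: "\<And>w z. (\<lambda>y. T y w z) differentiable (at x)"
  shows "bilinear (\<lambda>w z. D (\<lambda>y. T y w z) x u)"
  unfolding bilinear_def
proof (intro conjI allI)
  show "linear (\<lambda>z. D (\<lambda>y. T y w z) x u)" for w
    by (rule linear_D_linear_family[OF S _ dT]) (use T in \<open>simp add: bilinear_def\<close>)
  show "linear (\<lambda>w. D (\<lambda>y. T y w z) x u)" for z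
    by (rule linear_D_linear_family[where T = "\<lambda>y w. T y w z", OF S _ dT])
      (use T in \<open>simp add: bilinear_def\<close>)
qed

section \<open>Koszul formula, orthonormal frames and the Levi-Civita connection\<close>

definition koszul :: "'e::euclidean_space metric \<Rightarrow> 'e \<Rightarrow> 'e \<Rightarrow> 'e \<Rightarrow> 'e \<Rightarrow> real" where
  "koszul G x u v z = D (\<lambda>y. G y v z) x u + D (\<lambda>y. G y u z) x v - D (\<lambda>y. G y u v) x z"

text \<open>Two solutions of the Koszul equation differ by a vector orthogonal to itself, so
  positivity resolves the \<open>THE\<close>. Christoffel symbols are computed below by exhibiting a
  solution.\<close>

lemma christoffel_eqI:
  assumes "bilinear (G x)" "\<And>u. u \<noteq> 0 \<Longrightarrow> G x u u > 0" "\<And>z. 2 * G x w z = koszul G x u v z"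
  shows "christoffel G x u v = w"
  unfolding christoffel_def koszul_def[symmetric]
proof (rule the_equality)
  fix w' assume "\<forall>z. 2 * G x w' z = koszul G x u v z"
  then have "G x (w' - w) (w' - w) = 0"
    using assms(3) by (simp add: bilinear_lsub[OF assms(1)]) (metis mult_cancel_left zero_neq_numeral)
  then show "w' = w"
    using assms(2)[of "w' - w"] by auto
qed (use assms(3) in blast)

text \<open>The tensor calculus takes place on one open coordinate set; charts and transition maps
  return only when the atlas is assembled.\<close>

locale local_metric =
  fixes G :: "'e::euclidean_space metric" and S :: "'e set"
  assumes open_S: "open S"
    and bilinear_G: "\<And>x. x \<in> S \<Longrightarrow> bilinear (G x)"
    and sym_G: "\<And>x u v. x \<in> S \<Longrightarrow> G x u v = G x v u"
    and pos_G: "\<And>x u. x \<in> S \<Longrightarrow> u \<noteq> 0 \<Longrightarrow> G x u u > 0"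
    and smooth_G: "\<And>u v. smooth_on S (\<lambda>x. G x u v)"
begin

lemmas G_lin = bilinear_ladd[OF bilinear_G] bilinear_radd[OF bilinear_G]
  bilinear_lsub[OF bilinear_G] bilinear_rsub[OF bilinear_G]
  bilinear_lmul[OF bilinear_G] bilinear_rmul[OF bilinear_G]
  bilinear_lneg[OF bilinear_G] bilinear_rneg[OF bilinear_G]
  bilinear_lzero[OF bilinear_G] bilinear_rzero[OF bilinear_G]

lemma linear_G:
  assumes "x \<in> S"
  shows "linear (G x u)" "linear (\<lambda>u. G x u v)"
  using bilinear_G[OF assms] by (simp_all add: bilinear_def)

lemma smooth_G_fields:
  assumes "smooth_on S s" "smooth_on S t"
  shows "smooth_on S (\<lambda>x. G x (s x) (t x))"
  by (rule smooth_on_bilinear_family[OF open_S bilinear_G smooth_G assms])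

text \<open>The induction is over subsets of the standard basis. The span clause is what keeps the
  next basis vector independent of the frame built so far, at every point at once. The frame serves
  twice: as a substitute for the inverse metric and as a witness that \<open>laplacian\<close>
  chooses from a nonempty set.\<close>

lemma gram_schmidt:
  assumes "A \<subseteq> Basis"
  shows "\<exists>E. (\<forall>b\<in>A. smooth_on S (E b)) \<and> (\<forall>x\<in>S. \<forall>b\<in>A. E b x \<in> span A) \<and>
    (\<forall>x\<in>S. \<forall>b\<in>A. \<forall>b'\<in>A. G x (E b x) (E b' x) = (if b = b' then 1 else 0))"
proof -
  have "finite A" using assms finite_Basis by (rule finite_subset)
  then show ?thesis using assms
  proof (induction A)
    case (insert a A)
    then have "A \<subseteq> Basis" by simp
    from insert.IH[OF this] obtain E where E0: "\<forall>b\<in>A. smooth_on S (E b)"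
      "\<forall>x\<in>S. \<forall>b\<in>A. E b x \<in> span A"
      "\<forall>x\<in>S. \<forall>b\<in>A. \<forall>b'\<in>A. G x (E b x) (E b' x) = (if b = b' then 1 else 0)"
      by (elim exE conjE)
    then have E: "\<And>b. b \<in> A \<Longrightarrow> smooth_on S (E b)"
      "\<And>x b. x \<in> S \<Longrightarrow> b \<in> A \<Longrightarrow> E b x \<in> span A"
      "\<And>x b b'. x \<in> S \<Longrightarrow> b \<in> A \<Longrightarrow> b' \<in> A \<Longrightarrow> G x (E b x) (E b' x) = (if b = b' then 1 else 0)"
      by simp_all
    define w where "w x = a - (\<Sum>b\<in>A. G x a (E b x) *\<^sub>R E b x)" for x
    define n where "n x = G x (w x) (w x)" for x
    have a: "a \<notin> span A"
    proof -
      have "a \<notin> span (Basis - {a})"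
        using independent_Basis insert.prems unfolding dependent_def by blast
      moreover have "span A \<subseteq> span (Basis - {a})"
        using insert by (intro span_mono) auto
      ultimately show ?thesis by blast
    qed
    have sum_span: "(\<Sum>b\<in>A. G x a (E b x) *\<^sub>R E b x) \<in> span A" if "x \<in> S" for x
      by (intro span_sum span_scale E(2) that)
    have n_pos: "n x > 0" if "x \<in> S" for x
      unfolding n_def using sum_span[OF that] a by (intro pos_G that) (auto simp: w_def)
    have w_smooth: "smooth_on S w"
      unfolding w_def[abs_def]
      by (intro smooth_on_diff[OF open_S] smooth_on_const smooth_on_sum[OF open_S]
        smooth_on_scaleR[OF open_S] smooth_G_fields[OF smooth_on_const] E(1))
    have n_smooth: "smooth_on S n"
      unfolding n_def[abs_def]
      by (rule smooth_G_fields[OF w_smooth w_smooth])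
    have w_orth: "G x (w x) (E b x) = 0" if "x \<in> S" "b \<in> A" for x b
    proof -
      have "G x (\<Sum>b\<in>A. G x a (E b x) *\<^sub>R E b x) (E b x)
          = (\<Sum>c\<in>A. G x a (E c x) * G x (E c x) (E b x))"
        by (simp add: linear_sum[OF linear_G(2)[OF that(1)]] G_lin that)
      also have "\<dots> = (\<Sum>c\<in>A. if c = b then G x a (E b x) else 0)"
        by (rule sum.cong) (use that E(3) in auto)
      also have "\<dots> = G x a (E b x)"
        using that insert.hyps by simp
      finally show ?thesis
        by (simp add: w_def G_lin that)
    qed
    \<comment> \<open>Normalization by a power of \<open>n\<close>, the squared length of
      \<open>w\<close>: \<open>smooth_on_powr\<close> applies because \<open>n\<close> is positive
      on \<open>S\<close>.\<close>
    define E' where "E' = E(a := \<lambda>x. n x powr (- 1 / 2) *\<^sub>R w x)"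
    have E'_a: "E' a = (\<lambda>x. n x powr (- 1 / 2) *\<^sub>R w x)" and E'_A: "\<And>b. b \<in> A \<Longrightarrow> E' b = E b"
      using insert.hyps by (auto simp: E'_def)
    have "smooth_on S (E' b)" if "b \<in> insert a A" for b
      using that E'_A E(1) unfolding insert_iff
      by (auto simp: E'_a intro!: smooth_on_scaleR smooth_on_powr open_S n_smooth w_smooth n_pos)
    moreover have "E' b x \<in> span (insert a A)" if "x \<in> S" "b \<in> insert a A" for x b
    proof (cases "b = a")
      case True
      have "w x \<in> span (insert a A)"
        unfolding w_def using sum_span[OF that(1)] span_mono[of A "insert a A"]
        by (intro span_diff) (auto intro: span_base)
      then show ?thesis
        by (simp add: True E'_a span_scale)
    next
      case False
      then show ?thesis
        using that E'_A E(2) span_mono[of A "insert a A"] by auto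
    qed
    moreover have "G x (E' b x) (E' b' x) = (if b = b' then 1 else 0)"
      if x: "x \<in> S" and "b \<in> insert a A" "b' \<in> insert a A" for x b b'
    proof -
      have aa: "G x (E' a x) (E' a x) = 1"
      proof -
        have "G x (E' a x) (E' a x) = (n x powr (- 1 / 2) * n x powr (- 1 / 2)) * n x"
          by (simp add: E'_a G_lin x n_def)
        also have "n x powr (- 1 / 2) * n x powr (- 1 / 2) = n x powr (- 1)"
          by (simp add: powr_add[symmetric])
        also have "\<dots> * n x = 1"
          using n_pos[OF x] by (simp add: powr_minus)
        finally show ?thesis .
      qed
      have ab: "G x (E' a x) (E' b x) = 0" if "b \<in> A" for b
        by (simp add: E'_a E'_A that G_lin x w_orth)
      show ?thesis
        using that aa ab sym_G[OF x] E(3)[OF x] insert.hyps E'_A by auto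
    qed
    ultimately show ?case by blast
  qed auto
qed

corollary orthonormal_frame_exists: "\<exists>E. orthonormal_frame_on G S E"
  using gram_schmidt[OF subset_refl] unfolding orthonormal_frame_on_def by blast

text \<open>Orthonormality recovers the coefficients \<open>c\<close> from the combination
  \<open>L c\<close>. Hence \<open>L\<close> is injective, and a linear injection of the model space
  into itself is onto.\<close>

lemma orthonormal_expansion:
  assumes "orthonormal_frame_on G S E" and x: "x \<in> S"
  shows "z = (\<Sum>b\<in>Basis. G x z (E b x) *\<^sub>R E b x)"
proof -
  define L where "L c = (\<Sum>b\<in>Basis. (c \<bullet> b) *\<^sub>R E b x)" for c
  have coeff: "G x (L c) (E b x) = c \<bullet> b" if "b \<in> Basis" for b c
  proof -
    have "G x (L c) (E b x) = (\<Sum>b'\<in>Basis. (c \<bullet> b') * G x (E b' x) (E b x))"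
      by (simp add: L_def linear_sum[OF linear_G(2)[OF x]] G_lin x)
    also have "\<dots> = (\<Sum>b'\<in>Basis. if b' = b then c \<bullet> b else 0)"
      by (rule sum.cong) (use assms that in \<open>auto simp: orthonormal_frame_on_def\<close>)
    finally show ?thesis using that by simp
  qed
  have "linear L"
    by (rule linearI)
      (simp_all add: L_def inner_add_left scaleR_add_left sum.distrib scaleR_sum_right)
  moreover have "inj L"
    by (rule injI, rule euclidean_eqI) (metis coeff)
  ultimately obtain c where "z = L c"
    by (metis linear_injective_imp_surjective surjD)
  then show ?thesis
    using coeff by (simp add: L_def)
qed

lemma D_G_sym:
  assumes "x \<in> S"
  shows "D (\<lambda>y. G y u v) x z = D (\<lambda>y. G y v u) x z"
  by (rule fun_cong[OF D_cong[OF open_S assms]]) (rule sym_G)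

lemma bilinear_D_G: "x \<in> S \<Longrightarrow> bilinear (\<lambda>u v. D (\<lambda>y. G y u v) x z)"
  by (rule bilinear_D_bilinear_family[OF open_S])
    (auto intro: bilinear_G smooth_on_differentiable[OF smooth_G])

lemma linear_D_G: "x \<in> S \<Longrightarrow> linear (\<lambda>z. D (\<lambda>y. G y u v) x z)"
  by (intro linear_frechet_derivative smooth_on_differentiable[OF smooth_G])

lemma linear_koszul:
  assumes "x \<in> S"
  shows "linear (\<lambda>u. koszul G x u v z)" "linear (\<lambda>v. koszul G x u v z)" "linear (\<lambda>z. koszul G x u v z)"
  using bilinear_D_G[OF assms] linear_D_G[OF assms]
  unfolding koszul_def[abs_def] bilinear_def
  by (auto intro!: linear_compose_add linear_compose_sub)

lemma koszul_sym: "x \<in> S \<Longrightarrow> koszul G x u v z = koszul G x v u z"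
  unfolding koszul_def using D_G_sym[of x u v] by simp

text \<open>The Koszul expression is linear in its last argument, so its values on an orthonormal
  frame are, up to the factor 2, the coefficients of the vector representing it. This settles
  existence in the \<open>THE\<close> and makes smooth dependence on the point visible without
  inverting the metric.\<close>

lemma christoffel_frame:
  assumes "orthonormal_frame_on G S E" and x: "x \<in> S"
  shows "christoffel G x u v = (\<Sum>b\<in>Basis. (koszul G x u v (E b x) / 2) *\<^sub>R E b x)"
proof (rule christoffel_eqI[of G x, OF bilinear_G[OF x] pos_G[OF x]])
  fix z
  have "koszul G x u v z = koszul G x u v (\<Sum>b\<in>Basis. G x z (E b x) *\<^sub>R E b x)"
    using orthonormal_expansion[OF assms, of z] by simp
  also have "\<dots> = (\<Sum>b\<in>Basis. G x z (E b x) * koszul G x u v (E b x))"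
    by (simp add: linear_sum[OF linear_koszul(3)[OF x]] linear_scale[OF linear_koszul(3)[OF x]])
  also have "\<dots> = 2 * G x (\<Sum>b\<in>Basis. (koszul G x u v (E b x) / 2) *\<^sub>R E b x) z"
    by (simp add: linear_sum[OF linear_G(2)[OF x]] G_lin x sum_distrib_left sym_G[OF x, of z] mult.commute)
  finally show "2 * G x (\<Sum>b\<in>Basis. (koszul G x u v (E b x) / 2) *\<^sub>R E b x) z = koszul G x u v z" ..
qed

lemma christoffel_koszul:
  assumes x: "x \<in> S"
  shows "2 * G x (christoffel G x u v) z = koszul G x u v z"
proof -
  obtain E where E: "orthonormal_frame_on G S E"
    using orthonormal_frame_exists by blast
  have "2 * G x (christoffel G x u v) z = (\<Sum>b\<in>Basis. G x z (E b x) * koszul G x u v (E b x))"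
    unfolding christoffel_frame[OF E x]
    by (simp add: linear_sum[OF linear_G(2)[OF x]] G_lin x sum_distrib_left sym_G[OF x, of z] mult.commute)
  also have "\<dots> = koszul G x u v (\<Sum>b\<in>Basis. G x z (E b x) *\<^sub>R E b x)"
    by (simp add: linear_sum[OF linear_koszul(3)[OF x]] linear_scale[OF linear_koszul(3)[OF x]])
  finally show ?thesis
    using orthonormal_expansion[OF E x, of z] by simp
qed

lemma smooth_christoffel: "smooth_on S (\<lambda>x. christoffel G x u v)"
proof -
  obtain E where E: "orthonormal_frame_on G S E"
    using orthonormal_frame_exists by blast
  then have E_smooth: "smooth_on S (E b)" if "b \<in> Basis" for b
    using that by (simp add: orthonormal_frame_on_def)
  have "smooth_on S (\<lambda>x. koszul G x u v (E b x))" if "b \<in> Basis" for b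
  proof (rule smooth_on_linear_family[OF open_S linear_koszul(3) _ E_smooth[OF that]])
    show "smooth_on S (\<lambda>x. koszul G x u v z)" for z
      unfolding koszul_def
      by (intro smooth_on_add smooth_on_diff open_S smooth_on_D smooth_G)
  qed
  then have "smooth_on S (\<lambda>x. \<Sum>b\<in>Basis. ((1 / 2) * koszul G x u v (E b x)) *\<^sub>R E b x)"
    by (intro smooth_on_sum smooth_on_scaleR smooth_on_mult smooth_on_const open_S E_smooth)
  then show ?thesis
    using smooth_on_cong[OF open_S, of "\<lambda>x. christoffel G x u v"] christoffel_frame[OF E] by simp
qed

lemma christoffel_sym: "x \<in> S \<Longrightarrow> christoffel G x u v = christoffel G x v u"
  by (simp add: christoffel_def koszul_def[symmetric] koszul_sym)

lemma bilinear_christoffel: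
  assumes x: "x \<in> S"
  shows "bilinear (christoffel G x)"
proof -
  have "linear (\<lambda>u. christoffel G x u v)" for v
  proof (rule linearI; rule christoffel_eqI[of G x, OF bilinear_G[OF x] pos_G[OF x]])
    show "2 * G x (christoffel G x a v + christoffel G x b v) z = koszul G x (a + b) v z" for a b z
      by (simp add: G_lin x distrib_left christoffel_koszul linear_add[OF linear_koszul(1)])
    show "2 * G x (r *\<^sub>R christoffel G x a v) z = koszul G x (r *\<^sub>R a) v z" for r a z
      using christoffel_koszul[OF x, of a v z]
      by (simp add: G_lin x linear_scale[OF linear_koszul(1)])
  qed
  moreover have "christoffel G x u = (\<lambda>v. christoffel G x v u)" for u
    using christoffel_sym[OF x] by blast
  ultimately show ?thesis
    unfolding bilinear_def by metis
qed

lemmas christoffel_lin = bilinear_ladd[OF bilinear_christoffel] bilinear_radd[OF bilinear_christoffel]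
  bilinear_lmul[OF bilinear_christoffel] bilinear_rmul[OF bilinear_christoffel]

text \<open>In the sum of the Koszul formulas for \<open>(u, v, w)\<close> and
  \<open>(u, w, v)\<close> the derivatives along \<open>v\<close> and \<open>w\<close>
  cancel.\<close>

lemma metric_compatible:
  assumes "x \<in> S"
  shows "D (\<lambda>y. G y v w) x u = G x (christoffel G x u v) w + G x v (christoffel G x u w)"
  using christoffel_koszul[OF assms, of u v w] christoffel_koszul[OF assms, of u w v]
    D_G_sym[OF assms, of v w u] sym_G[OF assms, of v]
  by (simp add: koszul_def)

end

section \<open>Covariant derivatives along maps and the curvature tensor\<close>

lemma cov_eq_cov_along: "cov G X Y = cov_along G (\<lambda>x. x) X Y"
  by (simp add: cov_def[abs_def] cov_along_def[abs_def])

context local_metric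
begin

lemma smooth_cov:
  assumes "smooth_on S Y"
  shows "smooth_on S (cov G (\<lambda>_. u) Y)"
  unfolding cov_def[abs_def]
  by (intro smooth_on_add open_S smooth_on_D assms
      smooth_on_bilinear_family[OF open_S bilinear_christoffel smooth_christoffel smooth_on_const assms])

lemma riemann_eq:
  assumes x: "x \<in> S"
  shows "riemann G x u v w =
    D (\<lambda>y. christoffel G y v w) x u + christoffel G x u (christoffel G x v w)
    - (D (\<lambda>y. christoffel G y u w) x v + christoffel G x v (christoffel G x u w))"
  by (simp add: riemann_def cov_def[abs_def])

lemma has_derivative_christoffel_along:
  assumes W: "open W" "x \<in> W" and h: "smooth_on W h" "h ` W \<subseteq> S"
    and a: "smooth_on W a" and b: "smooth_on W b"
  shows "((\<lambda>y. christoffel G (h y) (a y) (b y)) has_derivative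
    (\<lambda>u. D (\<lambda>z. christoffel G z (a x) (b x)) (h x) (D h x u)
      + christoffel G (h x) (D a x u) (b x) + christoffel G (h x) (a x) (D b x u))) (at x)"
proof -
  have hS: "h y \<in> S" if "y \<in> W" for y
    using h that by blast
  have comp: "((\<lambda>y. christoffel G (h y) p q) has_derivative
      (\<lambda>u. D (\<lambda>z. christoffel G z p q) (h x) (D h x u))) (at x)" for p q
    using diff_chain_at[OF smooth_on_has_derivative[OF h(1) W(2)]
        smooth_on_has_derivative[OF smooth_christoffel hS[OF W(2)]]] by (simp add: o_def)
  have "((\<lambda>y. christoffel G (h y) (a y) (b y)) has_derivative
    (\<lambda>u. D (\<lambda>y. christoffel G (h y) (a x) (b x)) x u
      + christoffel G (h x) (D a x u) (b x) + christoffel G (h x) (a x) (D b x u))) (at x)"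
    by (rule has_derivative_bilinear_family[where T = "\<lambda>y. christoffel G (h y)", OF W _ _
          smooth_on_has_derivative[OF a W(2)] smooth_on_has_derivative[OF b W(2)]])
      (use bilinear_christoffel hS comp differentiable_def in blast)+
  then show ?thesis
    using D_eqI[OF comp] by simp
qed

text \<open>In the expanded second covariant derivative, the second derivatives of \<open>V\<close>
  and of \<open>h\<close> are symmetric in the two directions, and the two terms containing a first
  derivative of \<open>V\<close> are exchanged. What survives is the coordinate expression of the
  curvature. The lemma gives the ambient curvature on tangent vectors of an immersion without
  extending fields off its image.\<close>

lemma cov_along_commutator:
  fixes h :: "'d::euclidean_space \<Rightarrow> 'e"
  assumes W: "open W" "x \<in> W" and h: "smooth_on W h" "h ` W \<subseteq> S" and V: "smooth_on W V"
  shows "cov_along G h (\<lambda>_. u) (cov_along G h (\<lambda>_. v) V) x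
      - cov_along G h (\<lambda>_. v) (cov_along G h (\<lambda>_. u) V) x
    = riemann G (h x) (D h x u) (D h x v) (V x)"
proof -
  have hx: "h x \<in> S"
    using W h by blast
  have "cov_along G h (\<lambda>_. p) (cov_along G h (\<lambda>_. q) V) x =
      D (\<lambda>y. D V y q) x p
      + (D (\<lambda>z. christoffel G z (D h x q) (V x)) (h x) (D h x p)
        + christoffel G (h x) (D (\<lambda>y. D h y q) x p) (V x) + christoffel G (h x) (D h x q) (D V x p))
      + (christoffel G (h x) (D h x p) (D V x q)
        + christoffel G (h x) (D h x p) (christoffel G (h x) (D h x q) (V x)))" for p q
  proof -
    have "D (cov_along G h (\<lambda>_. q) V) x p = D (\<lambda>y. D V y q) x p
      + (D (\<lambda>z. christoffel G z (D h x q) (V x)) (h x) (D h x p)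
        + christoffel G (h x) (D (\<lambda>y. D h y q) x p) (V x) + christoffel G (h x) (D h x q) (D V x p))"
      unfolding cov_along_def[abs_def]
      by (rule D_eqI) (intro has_derivative_add smooth_on_has_derivative[OF _ W(2)] smooth_on_D V
          has_derivative_christoffel_along[OF W h] h)
    then show ?thesis
      by (simp add: cov_along_def[of _ _ _ "cov_along _ _ _ _"] cov_along_def[of _ _ _ V]
          christoffel_lin[OF hx])
  qed
  then show ?thesis
    using second_derivative_commute[OF W V, of u v] second_derivative_commute[OF W h(1), of u v]
    by (simp add: riemann_eq[OF hx])
qed

lemma cov_commutator:
  assumes "x \<in> S" "smooth_on S V"
  shows "cov G (\<lambda>_. u) (cov G (\<lambda>_. v) V) x - cov G (\<lambda>_. v) (cov G (\<lambda>_. u) V) x = riemann G x u v (V x)"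
  using cov_along_commutator[OF open_S assms(1) smooth_on_ident _ assms(2)]
  by (simp add: cov_eq_cov_along)

lemma D_metric_fields:
  assumes x: "x \<in> S" and V: "smooth_on S V" and W: "smooth_on S W"
  shows "D (\<lambda>y. G y (V y) (W y)) x u = G x (cov G (\<lambda>_. u) V x) (W x) + G x (V x) (cov G (\<lambda>_. u) W x)"
proof -
  have "D (\<lambda>y. G y (V y) (W y)) x u
      = D (\<lambda>y. G y (V x) (W x)) x u + G x (D V x u) (W x) + G x (V x) (D W x u)"
    by (rule D_eqI, rule has_derivative_bilinear_family[OF open_S x _
          smooth_on_differentiable[OF smooth_G x]
          smooth_on_has_derivative[OF V x] smooth_on_has_derivative[OF W x]])
      (rule bilinear_G)
  then show ?thesis
    by (simp add: cov_def metric_compatible[OF x] G_lin x)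
qed

lemma riemann_skew12: "riemann G x u v w = - riemann G x v u w"
  by (simp add: riemann_def)

lemma riemann_bianchi:
  assumes x: "x \<in> S"
  shows "riemann G x u v w + riemann G x v w u + riemann G x w u v = 0"
proof -
  have "D (\<lambda>y. christoffel G y p q) x r = D (\<lambda>y. christoffel G y q p) x r" for p q r
    by (rule fun_cong[OF D_cong[OF open_S x]]) (rule christoffel_sym)
  then show ?thesis
    unfolding riemann_eq[OF x]
    using christoffel_sym[OF x, of u v] christoffel_sym[OF x, of v w] christoffel_sym[OF x, of w u]
    by simp
qed

lemma linear_riemann:
  assumes x: "x \<in> S"
  shows "linear (\<lambda>u. riemann G x u v w)" "linear (\<lambda>w. riemann G x u v w)"
proof -
  have d: "(\<lambda>y. christoffel G y p q) differentiable (at x)" for p q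
    by (rule smooth_on_differentiable[OF smooth_christoffel x])
  have "bilinear (\<lambda>p q. D (\<lambda>y. christoffel G y p q) x z)" for z
    by (rule bilinear_D_bilinear_family[OF open_S x bilinear_christoffel d])
  then have l: "linear (\<lambda>p. D (\<lambda>y. christoffel G y p q) x z)" "linear (\<lambda>p. D (\<lambda>y. christoffel G y q p) x z)"
    for q z by (simp_all add: bilinear_def)
  have l': "linear (\<lambda>z. D (\<lambda>y. christoffel G y p q) x z)" for p q
    by (rule linear_frechet_derivative[OF d])
  note lin = christoffel_lin[OF x] linear_add[OF l(1)] linear_add[OF l(2)] linear_add[OF l']
    linear_scale[OF l(1)] linear_scale[OF l(2)] linear_scale[OF l']
  show "linear (\<lambda>u. riemann G x u v w)" "linear (\<lambda>w. riemann G x u v w)"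
    by (rule linearI; simp add: riemann_eq[OF x] lin algebra_simps)+
qed

text \<open>The second derivatives of the function \<open>G y w z\<close> commute. Expanding them by
  metric compatibility, the products of two first covariant derivatives are symmetric in the
  directions and drop out, leaving the sum of the two curvature terms.\<close>

lemma riemann_skew34:
  assumes x: "x \<in> S"
  shows "G x (riemann G x u v w) z = - G x (riemann G x u v z) w"
proof -
  let ?N = "\<lambda>u. cov G (\<lambda>_. u)" and ?w = "\<lambda>_::'e. w" and ?z = "\<lambda>_::'e. z"
  have N: "smooth_on S (?N q (\<lambda>_. r))" for q r
    by (intro smooth_cov smooth_on_const)
  have 2: "D (\<lambda>y. D (\<lambda>y. G y w z) y q) x p
      = G x (?N p (?N q ?w) x) z + G x (?N q ?w x) (?N p ?z x)
      + (G x (?N p ?w x) (?N q ?z x) + G x w (?N p (?N q ?z) x))" for p q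
  proof -
    have "D (\<lambda>y. D (\<lambda>y. G y w z) y q) x p = D (\<lambda>y. G y (?N q ?w y) z + G y w (?N q ?z y)) x p"
      by (rule fun_cong[OF D_cong[OF open_S x]]) (rule D_metric_fields[OF _ smooth_on_const smooth_on_const])
    also have "\<dots> = D (\<lambda>y. G y (?N q ?w y) z) x p + D (\<lambda>y. G y w (?N q ?z y)) x p"
      by (rule D_eqI) (intro has_derivative_add smooth_on_has_derivative[OF _ x] smooth_G_fields
          N smooth_on_const)
    finally show ?thesis
      using D_metric_fields[OF x N smooth_on_const] D_metric_fields[OF x smooth_on_const N] by simp
  qed
  have "G x (?N u (?N v ?w) x) z - G x (?N v (?N u ?w) x) z
      + (G x w (?N u (?N v ?z) x) - G x w (?N v (?N u ?z) x)) = 0"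
    using second_derivative_commute[OF open_S x smooth_G, of w z v u] unfolding 2 by simp
  then have "G x (riemann G x u v w) z + G x w (riemann G x u v z) = 0"
    by (simp add: riemann_def G_lin x)
  then show ?thesis
    using sym_G[OF x] by (metis add.commute add_eq_0_iff)
qed

end

section \<open>Curvature of a Kaehler metric\<close>

locale local_kaehler = local_metric G S for G :: "'e::euclidean_space metric" and S +
  fixes J :: "'e \<Rightarrow> 'e \<Rightarrow> 'e"
  assumes linear_J: "\<And>x. x \<in> S \<Longrightarrow> linear (J x)"
    and J_J: "\<And>x u. x \<in> S \<Longrightarrow> J x (J x u) = - u"
    and smooth_J: "\<And>u. smooth_on S (\<lambda>x. J x u)"
    and G_J: "\<And>x u v. x \<in> S \<Longrightarrow> G x (J x u) (J x v) = G x u v"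
    and parallel_J: "\<And>x X Y. x \<in> S \<Longrightarrow> smooth_on S X \<Longrightarrow> smooth_on S Y \<Longrightarrow>
      cov G X (\<lambda>y. J y (Y y)) x = J x (cov G X Y x)"
begin

lemma cov_cong:
  assumes "x \<in> S" "\<And>y. y \<in> S \<Longrightarrow> Y y = Z y"
  shows "cov G X Y x = cov G X Z x"
  using D_cong[OF open_S assms(1), of Y Z] assms by (simp add: cov_def)

text \<open>Since \<open>J\<close> is parallel it passes through both covariant derivatives of the
  field \<open>J y w\<close>, and the commutator of these depends only on the value of that field at
  \<open>x\<close>. With \<open>G_J\<close> this yields the invariance that the polarization
  requires.\<close>

lemma riemann_J:
  assumes x: "x \<in> S"
  shows "riemann G x u v (J x w) = J x (riemann G x u v w)"
proof -
  have *: "cov G (\<lambda>_. p) (cov G (\<lambda>_. q) (\<lambda>y. J y w)) x = J x (cov G (\<lambda>_. p) (cov G (\<lambda>_. q) (\<lambda>_. w)) x)"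
    for p q
  proof -
    have "cov G (\<lambda>_. p) (cov G (\<lambda>_. q) (\<lambda>y. J y w)) x
        = cov G (\<lambda>_. p) (\<lambda>y. J y (cov G (\<lambda>_. q) (\<lambda>_. w) y)) x"
      by (intro cov_cong x parallel_J smooth_on_const)
    also have "\<dots> = J x (cov G (\<lambda>_. p) (cov G (\<lambda>_. q) (\<lambda>_. w)) x)"
      by (intro parallel_J x smooth_on_const smooth_cov)
    finally show ?thesis .
  qed
  have "riemann G x u v (J x w) = cov G (\<lambda>_. u) (cov G (\<lambda>_. v) (\<lambda>y. J y w)) x
      - cov G (\<lambda>_. v) (cov G (\<lambda>_. u) (\<lambda>y. J y w)) x"
    by (rule cov_commutator[OF x smooth_J, symmetric])
  then show ?thesis
    by (simp add: * riemann_def linear_diff[OF linear_J[OF x]])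
qed

lemma totally_real_curvature:
  assumes x: "x \<in> S" and hol: "\<And>u. u \<noteq> 0 \<Longrightarrow> sectional_curvature G x u (J x u) = c"
    and tr: "G x (J x v) u = 0"
  shows "G x (riemann G x u v v) u = c / 4 * (G x u u * G x v v - (G x u v)\<^sup>2)"
proof (rule constant_holomorphic_curvature_totally_real[where R = "\<lambda>u v w z. G x (riemann G x u v w) z"
      and J = "J x" and G = "G x"])
  show "linear (\<lambda>u. G x (riemann G x u v w) z)" "linear (\<lambda>w. G x (riemann G x u v w) z)" for u v w z
    using linear_compose[OF linear_riemann(1)[OF x] linear_G(2)[OF x]]
      linear_compose[OF linear_riemann(2)[OF x] linear_G(2)[OF x]] by (simp_all add: o_def)
  show "G x (riemann G x u v w) z = - G x (riemann G x v u w) z" for u v w z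
    using riemann_skew12[of x u v w] by (simp add: G_lin x)
  show "G x (riemann G x u v w) z = - G x (riemann G x u v z) w" for u v w z
    by (rule riemann_skew34[OF x])
  show "G x (riemann G x u v w) z + G x (riemann G x v w u) z + G x (riemann G x w u v) z = 0"
    for u v w z
    using riemann_bianchi[OF x, of u v w]
    by (simp add: bilinear_ladd[OF bilinear_G[OF x], symmetric] bilinear_lzero[OF bilinear_G[OF x]])
  show "G x (riemann G x u v (J x w)) (J x z) = G x (riemann G x u v w) z" for u v w z
    by (simp add: riemann_J G_J x)
  show "G x (riemann G x u (J x u) (J x u)) u = c * (G x u u)\<^sup>2" for u
  proof (cases "u = 0")
    case True
    then show ?thesis by (simp add: G_lin x)
  next
    case False
    \<comment> \<open>Applying \<open>J\<close> to both arguments gives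
      \<open>G x u (J x u) = - G x (J x u) u\<close>. With this the denominator of the sectional
      curvature becomes \<open>(G x u u)^2\<close>.\<close>
    have "G x u (J x u) = 0"
      using G_J[OF x, of u "J x u"] sym_G[OF x, of u] by (simp add: J_J G_lin x)
    then show ?thesis
      using hol[OF False] pos_G[OF x False]
      by (simp add: sectional_curvature_def G_J x field_simps power2_eq_square)
  qed
qed (use x tr bilinear_G linear_J J_J sym_G G_J in auto)

end

subsection \<open>Warped products\<close>

lemma cov_along_cong:
  assumes "open W" "x \<in> W" "\<And>y. y \<in> W \<Longrightarrow> Y y = Z y"
  shows "cov_along G h X Y x = cov_along G h X Z x"
  using D_cong[OF assms(1,2), of Y Z] assms by (simp add: cov_along_def)

locale local_warped =
  B: local_metric gB VB + F: local_metric gF VF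
  for gB :: "'eb::euclidean_space metric" and VB and gF :: "'ef::euclidean_space metric" and VF +
  fixes \<phi> :: "'eb \<Rightarrow> real"
  assumes smooth_\<phi>: "smooth_on VB \<phi>" and pos_\<phi>: "\<And>x. x \<in> VB \<Longrightarrow> \<phi> x > 0"
begin

definition gW :: "('eb \<times> 'ef) metric" where
  "gW z u v = gB (fst z) (fst u) (fst v) + (\<phi> (fst z))\<^sup>2 * gF (snd z) (snd u) (snd v)"

lemma bilinear_gW:
  assumes "x \<in> VB" "y \<in> VF"
  shows "bilinear (gW (x, y))"
  unfolding bilinear_def
  by (intro conjI allI linearI; simp add: gW_def B.G_lin F.G_lin assms algebra_simps)

lemma pos_gW:
  assumes "x \<in> VB" "y \<in> VF" "u \<noteq> 0"
  shows "gW (x, y) u u > 0"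
proof (cases "fst u = 0")
  case True
  then have "snd u \<noteq> 0" using assms(3) by (simp add: prod_eq_iff)
  then show ?thesis
    using True F.pos_G[OF assms(2)] pos_\<phi>[OF assms(1)] by (simp add: gW_def B.G_lin assms)
next
  case False
  moreover have "gF y (snd u) (snd u) \<ge> 0"
    using F.pos_G[OF assms(2), of "snd u"] F.G_lin(9)[OF assms(2)] by (cases "snd u = 0") auto
  ultimately show ?thesis
    using B.pos_G[OF assms(1)] by (simp add: gW_def add_pos_nonneg)
qed

lemma D_gW:
  assumes "x \<in> VB" "y \<in> VF"
  shows "D (\<lambda>z. gW z u v) (x, y) p = D (\<lambda>x. gB x (fst u) (fst v)) x (fst p)
    + 2 * \<phi> x * D \<phi> x (fst p) * gF y (snd u) (snd v)
    + (\<phi> x)\<^sup>2 * D (\<lambda>y. gF y (snd u) (snd v)) y (snd p)"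
proof -
  have fst': "(fst has_derivative fst) (at (x, y))" and snd': "(snd has_derivative snd) (at (x, y))"
    by (auto intro: bounded_linear_imp_has_derivative bounded_linear_fst bounded_linear_snd)
  have 1: "((\<lambda>z. gB (fst z) a b) has_derivative (\<lambda>p. D (\<lambda>x. gB x a b) x (fst p))) (at (x, y))" for a b
    using diff_chain_at[OF fst'] smooth_on_has_derivative[OF B.smooth_G assms(1)] by (force simp: o_def)
  have 2: "((\<lambda>z. gF (snd z) a b) has_derivative (\<lambda>p. D (\<lambda>x. gF x a b) y (snd p))) (at (x, y))" for a b
    using diff_chain_at[OF snd'] smooth_on_has_derivative[OF F.smooth_G assms(2)] by (force simp: o_def)
  have 3: "((\<lambda>z. \<phi> (fst z)) has_derivative (\<lambda>p. D \<phi> x (fst p))) (at (x, y))"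
    using diff_chain_at[OF fst'] smooth_on_has_derivative[OF smooth_\<phi> assms(1)] by (force simp: o_def)
  show ?thesis
    unfolding gW_def
    by (rule trans[OF D_eqI[OF has_derivative_add[OF 1 has_derivative_mult[OF has_derivative_power[OF 3] 2]]]])
      (simp add: algebra_simps)
qed

text \<open>The leaves parallel to the base are totally geodesic: the fibre part of the metric, and
  with it the derivative of \<open>\<phi>\<close>, enters the Koszul formula only with a zero
  argument.\<close>

lemma christoffel_gW_base:
  assumes x: "x \<in> VB" and y: "y \<in> VF"
  shows "christoffel gW (x, y) (a, 0) (a', 0) = (christoffel gB x a a', 0)"
proof (rule christoffel_eqI[of gW "(x, y)", OF bilinear_gW[OF x y] pos_gW[OF x y]])
  fix z
  have zero: "D (\<lambda>y. gF y p 0) y q = 0" "D (\<lambda>y. gF y 0 p) y q = 0" for p q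
    using D_cong[OF F.open_S y, of "\<lambda>y. gF y p 0" "\<lambda>_. 0"] D_cong[OF F.open_S y, of "\<lambda>y. gF y 0 p" "\<lambda>_. 0"]
    by (simp_all add: F.G_lin)
  show "2 * gW (x, y) (christoffel gB x a a', 0) z = koszul gW (x, y) (a, 0) (a', 0) z"
    using B.christoffel_koszul[OF x, of a a' "fst z"]
    by (simp add: koszul_def D_gW[OF x y] zero F.G_lin y) (simp add: gW_def F.G_lin y)
qed

text \<open>The only surviving Koszul term is the derivative of the factor \<open>\<phi>^2\<close>.
  Dividing \<open>2 * \<phi> * D \<phi> x a\<close> by twice the factor \<open>\<phi>^2\<close> in
  the metric leaves the logarithmic derivative, the classical \<open>(X f / f) U\<close>.\<close>

lemma christoffel_gW_mixed:
  assumes x: "x \<in> VB" and y: "y \<in> VF"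
  shows "christoffel gW (x, y) (0, w) (a, 0) = (0, (D \<phi> x a / \<phi> x) *\<^sub>R w)"
    and "christoffel gW (x, y) (a, 0) (0, w) = (0, (D \<phi> x a / \<phi> x) *\<^sub>R w)"
proof -
  have zF: "D (\<lambda>y. gF y p 0) y q = 0" "D (\<lambda>y. gF y 0 p) y q = 0" for p q
    using D_cong[OF F.open_S y, of "\<lambda>y. gF y p 0" "\<lambda>_. 0"] D_cong[OF F.open_S y, of "\<lambda>y. gF y 0 p" "\<lambda>_. 0"]
    by (simp_all add: F.G_lin)
  have zB: "D (\<lambda>y. gB y p 0) x q = 0" "D (\<lambda>y. gB y 0 p) x q = 0" for p q
    using D_cong[OF B.open_S x, of "\<lambda>y. gB y p 0" "\<lambda>_. 0"] D_cong[OF B.open_S x, of "\<lambda>y. gB y 0 p" "\<lambda>_. 0"]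
    by (simp_all add: B.G_lin)
  have z0: "D (\<lambda>x. gB x p q) x 0 = 0" "D (\<lambda>y. gF y r s) y 0 = 0" "D \<phi> x 0 = 0" for p q r s
    by (simp_all add: D_linear(3) smooth_on_differentiable[OF B.smooth_G x]
        smooth_on_differentiable[OF F.smooth_G y] smooth_on_differentiable[OF smooth_\<phi> x])
  have G: "2 * gW (x, y) (0, (D \<phi> x a / \<phi> x) *\<^sub>R w) z = 2 * \<phi> x * D \<phi> x a * gF y w (snd z)" for z
    using pos_\<phi>[OF x] by (simp add: gW_def F.G_lin B.G_lin x y power2_eq_square)
  show "christoffel gW (x, y) (0, w) (a, 0) = (0, (D \<phi> x a / \<phi> x) *\<^sub>R w)"
    and "christoffel gW (x, y) (a, 0) (0, w) = (0, (D \<phi> x a / \<phi> x) *\<^sub>R w)"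
    by (rule christoffel_eqI[of gW "(x, y)", OF bilinear_gW[OF x y] pos_gW[OF x y]],
        assumption, unfold G,
        simp add: koszul_def D_gW[OF x y] zF zB z0 F.G_lin B.G_lin x y)+
qed

text \<open>The left side is \<open>- Hess \<phi> (a,a)\<close>, obtained from the ambient curvature
  of the plane of \<open>(a, 0)\<close> and a vertical vector. \<open>tg\<close> is assumed on all
  of \<open>W\<close> because the first covariant derivatives are differentiated again;
  \<open>iso\<close> and \<open>tr\<close> enter only at the point itself.\<close>

lemma hessian_eq:
  fixes h :: "'eb \<times> 'ef \<Rightarrow> 'en::euclidean_space"
  assumes N: "local_kaehler gN VN J"
    and hol: "\<And>z u. z \<in> VN \<Longrightarrow> u \<noteq> 0 \<Longrightarrow> sectional_curvature gN z u (J z u) = c"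
    and W: "open W" "(x, y) \<in> W" "W \<subseteq> VB \<times> VF" and h: "smooth_on W h" "h ` W \<subseteq> VN"
    and iso: "\<And>u v. gN (h (x, y)) (D h (x, y) u) (D h (x, y) v) = gW (x, y) u v"
    and tg: "\<And>z u v. z \<in> W \<Longrightarrow> cov_along gN h (\<lambda>_. u) (\<lambda>y. D h y v) z = D h z (christoffel gW z u v)"
    and tr: "\<And>u v. gN (h (x, y)) (J (h (x, y)) (D h (x, y) u)) (D h (x, y) v) = 0"
  shows "D \<phi> x (christoffel gB x a a) - D (\<lambda>y. D \<phi> y a) x a = c / 4 * \<phi> x * gB x a a"
proof -
  interpret N: local_kaehler gN VN J by (rule N)
  have x: "x \<in> VB" and y: "y \<in> VF" and hz: "h (x, y) \<in> VN"
    using W h by auto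
  have dh: "h differentiable (at z)" if "z \<in> W" for z
    by (rule smooth_on_differentiable[OF h(1) that])
  \<comment> \<open>The model space of the fibre has positive dimension, so a vertical direction
    exists; its squared length cancels at the end.\<close>
  obtain w :: 'ef where w: "w \<noteq> 0"
    using nonzero_Basis nonempty_Basis by blast
  define X :: "'eb \<times> 'ef" where "X = (a, 0)"
  define U :: "'eb \<times> 'ef" where "U = (0, w)"
  define P where "P = (\<lambda>x. christoffel gB x a a)"
  define l where "l = (\<lambda>x. D \<phi> x a / \<phi> x)"
  let ?N = "\<lambda>u. cov_along gN h (\<lambda>_. u)" and ?dh = "\<lambda>v z. D h z v"
  have mem: "fst z \<in> VB" "snd z \<in> VF" if "z \<in> W" for z
    using that W by auto
  have XX: "?N X (?dh X) z = D h z (P (fst z), 0)" if "z \<in> W" for z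
    using tg[OF that, of X X] christoffel_gW_base[OF mem[OF that], of a a] by (simp add: X_def P_def)
  have scale_U: "D h z (0, r *\<^sub>R w) = r *\<^sub>R D h z U" if "z \<in> W" for z r
    using D_linear(2)[OF dh[OF that], of r U] by (simp add: U_def)
  have UX: "?N U (?dh X) z = l (fst z) *\<^sub>R D h z U" if "z \<in> W" for z
    using tg[OF that, of U X] christoffel_gW_mixed(1)[OF mem[OF that], of w a] scale_U[OF that]
    by (simp add: X_def U_def l_def)
  have XU: "?N X (?dh U) z = l (fst z) *\<^sub>R D h z U" if "z \<in> W" for z
    using tg[OF that, of X U] christoffel_gW_mixed(2)[OF mem[OF that], of a w] scale_U[OF that]
    by (simp add: X_def U_def l_def)
  have fst': "(fst has_derivative fst) (at (x, y))"
    by (auto intro: bounded_linear_imp_has_derivative bounded_linear_fst)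
  \<comment> \<open>\<open>P\<close> depends on the base point alone, so in the direction
    \<open>U\<close> it can be frozen at \<open>P x\<close>. The outer derivative is then again that
    of \<open>dh\<close> on a fixed vector, and \<open>tg\<close> with the mixed symbol evaluates
    it.\<close>
  have UXX: "?N U (?N X (?dh X)) (x, y) = (D \<phi> x (P x) / \<phi> x) *\<^sub>R D h (x, y) U"
  proof -
    have "((\<lambda>z. P (fst z)) has_derivative (\<lambda>u. D P x (fst u))) (at (x, y))"
      using diff_chain_at[OF fst'] smooth_on_has_derivative[OF B.smooth_christoffel x]
      by (force simp: o_def P_def)
    then have s: "((\<lambda>z. (P (fst z), 0::'ef)) has_derivative (\<lambda>u. (D P x (fst u), 0))) (at (x, y))"
      by (intro has_derivative_Pair has_derivative_const)
    have P0: "D P x 0 = 0"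
      unfolding P_def by (intro D_linear(3) smooth_on_differentiable[OF B.smooth_christoffel x])
    have "((\<lambda>z. D h z (P (fst z), 0)) has_derivative
        (\<lambda>u. D (\<lambda>z. D h z (P (fst (x, y)), 0)) (x, y) u + D h (x, y) (D P x (fst u), 0))) (at (x, y))"
      using W(2) by (intro has_derivative_linear_family[OF W(1) _ _ _ s] linear_frechet_derivative dh
          smooth_on_differentiable[OF smooth_on_D[OF h(1)]])
    from D_eqI[OF this, of U] have "D (\<lambda>z. D h z (P (fst z), 0)) (x, y) U = D (\<lambda>z. D h z (P x, 0)) (x, y) U"
      using D_linear(3)[OF dh[OF W(2)]] by (simp add: U_def P0 zero_prod_def[symmetric])
    then have "?N U (\<lambda>z. D h z (P (fst z), 0)) (x, y) = ?N U (?dh (P x, 0)) (x, y)"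
      by (simp add: cov_along_def)
    also have "\<dots> = D h (x, y) (christoffel gW (x, y) U (P x, 0))"
      by (rule tg[OF W(2)])
    finally show ?thesis
      using cov_along_cong[OF W(1,2) XX] christoffel_gW_mixed(1)[OF x y, of w "P x"] scale_U[OF W(2)]
      by (simp add: U_def)
  qed
  have dl: "(l has_derivative (\<lambda>u. D l x u)) (at x)" and
    Dl: "D l x a = D (\<lambda>y. D \<phi> y a) x a / \<phi> x - (l x)\<^sup>2"
  proof -
    have l: "(l has_derivative (\<lambda>u. (D (\<lambda>y. D \<phi> y a) x u * \<phi> x - D \<phi> x a * D \<phi> x u) / (\<phi> x * \<phi> x))) (at x)"
      unfolding l_def
      using pos_\<phi>[OF x] smooth_on_has_derivative[OF smooth_\<phi> x]
        smooth_on_has_derivative[OF smooth_on_D[OF smooth_\<phi>] x, of a]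
      by (intro has_derivative_divide') auto
    then show "(l has_derivative (\<lambda>u. D l x u)) (at x)"
      using frechet_derivative_works differentiable_def by blast
    show "D l x a = D (\<lambda>y. D \<phi> y a) x a / \<phi> x - (l x)\<^sup>2"
      using pos_\<phi>[OF x] D_eqI[OF l, of a] by (simp add: l_def field_simps power2_eq_square)
  qed
  \<comment> \<open>The product rule for \<open>l\<close> times \<open>dh U\<close> gives the factor
    \<open>D l x a + (l x)^2\<close>. The quotient rule in \<open>Dl\<close> contributes
    \<open>- (l x)^2\<close>, so only the second derivative of \<open>\<phi>\<close> over
    \<open>\<phi>\<close> is left.\<close>
  have XUX: "?N X (?N U (?dh X)) (x, y) = (D (\<lambda>y. D \<phi> y a) x a / \<phi> x) *\<^sub>R D h (x, y) U"
  proof -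
    have "((\<lambda>z. l (fst z)) has_derivative (\<lambda>u. D l x (fst u))) (at (x, y))"
      using diff_chain_at[OF fst'] dl by (force simp: o_def)
    from D_eqI[OF has_derivative_scaleR[OF this
        smooth_on_has_derivative[OF smooth_on_D[OF h(1), of U] W(2)]], of X]
    have "D (\<lambda>z. l (fst z) *\<^sub>R D h z U) (x, y) X = l x *\<^sub>R D (?dh U) (x, y) X + D l x a *\<^sub>R D h (x, y) U"
      by (simp add: X_def)
    then have "?N X (\<lambda>z. l (fst z) *\<^sub>R D h z U) (x, y)
        = D l x a *\<^sub>R D h (x, y) U + l x *\<^sub>R ?N X (?dh U) (x, y)"
      by (simp add: cov_along_def N.christoffel_lin[OF hz] algebra_simps)
    also have "\<dots> = (D (\<lambda>y. D \<phi> y a) x a / \<phi> x) *\<^sub>R D h (x, y) U"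
      by (simp add: XU[OF W(2)] Dl power2_eq_square algebra_simps)
    finally show ?thesis
      using cov_along_cong[OF W(1,2) UX] by simp
  qed
  define k where "k = (D \<phi> x (P x) - D (\<lambda>y. D \<phi> y a) x a) / \<phi> x"
  have "riemann gN (h (x, y)) (D h (x, y) U) (D h (x, y) X) (D h (x, y) X) = k *\<^sub>R D h (x, y) U"
    using N.cov_along_commutator[OF W(1,2) h smooth_on_D[OF h(1)], of U X X] UXX XUX
    by (simp add: k_def diff_divide_distrib scaleR_diff_left)
  then have "k * gN (h (x, y)) (D h (x, y) U) (D h (x, y) U) = c / 4 *
      (gN (h (x, y)) (D h (x, y) U) (D h (x, y) U) * gN (h (x, y)) (D h (x, y) X) (D h (x, y) X)
       - (gN (h (x, y)) (D h (x, y) U) (D h (x, y) X))\<^sup>2)"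
    using N.totally_real_curvature[OF hz hol[OF hz] tr, of U X] by (simp add: N.G_lin hz)
  \<comment> \<open>\<open>U\<close> and \<open>X\<close> are orthogonal in the warped metric and
    \<open>X\<close> has squared length \<open>gB x a a\<close>, so the area term is a product from
    which the length of \<open>U\<close> can be cancelled.\<close>
  then have "k * gW (x, y) U U = c / 4 * gB x a a * gW (x, y) U U"
    unfolding iso by (simp add: gW_def U_def X_def B.G_lin F.G_lin x y)
  moreover have "gW (x, y) U U > 0"
    using w by (intro pos_gW x y) (simp add: U_def zero_prod_def)
  ultimately have "k = c / 4 * gB x a a" by simp
  then show ?thesis
    using pos_\<phi>[OF x] by (simp add: k_def P_def field_simps)
qed

end

text \<open>Differentiating \<open>D \<phi> y (E b y)\<close> also hits the frame vector, but the
  same term occurs in \<open>cov\<close> and cancels. Each summand is therefore the quadratic form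
  of \<open>hess\<close> on a unit vector, that is \<open>k\<close>.\<close>

lemma (in local_metric) frame_laplacian_eq:
  assumes E: "orthonormal_frame_on G T E" "open T" "T \<subseteq> S" and x: "x \<in> T" and \<phi>: "smooth_on S \<phi>"
    and hess: "\<And>a. D \<phi> x (christoffel G x a a) - D (\<lambda>y. D \<phi> y a) x a = k * G x a a"
  shows "frame_laplacian G E \<phi> x = real DIM('e) * k"
proof -
  have xS: "x \<in> S" using E x by blast
  have "D \<phi> x (cov G (E b) (E b) x) - D (\<lambda>y. D \<phi> y (E b y)) x (E b x) = k" if b: "b \<in> Basis" for b
  proof -
    have Eb: "smooth_on T (E b)"
      using E(1) b by (simp add: orthonormal_frame_on_def)
    have "((\<lambda>y. D \<phi> y (E b y)) has_derivative
        (\<lambda>u. D (\<lambda>y. D \<phi> y (E b x)) x u + D \<phi> x (D (E b) x u))) (at x)"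
      by (rule has_derivative_linear_family[OF open_S xS])
        (intro linear_frechet_derivative smooth_on_differentiable[OF \<phi>]
          smooth_on_differentiable[OF smooth_on_D[OF \<phi>] xS] smooth_on_has_derivative[OF Eb x]; assumption)+
    from D_eqI[OF this] have "D \<phi> x (cov G (E b) (E b) x) - D (\<lambda>y. D \<phi> y (E b y)) x (E b x) = k * G x (E b x) (E b x)"
      using hess[of "E b x"] D_linear(1)[OF smooth_on_differentiable[OF \<phi> xS]] by (simp add: cov_def)
    then show ?thesis
      using E(1) b x by (simp add: orthonormal_frame_on_def)
  qed
  then show ?thesis
    by (simp add: frame_laplacian_def)
qed

section \<open>From single charts to the atlas\<close>

lemma local_metric_chart:
  assumes "riemannian_manifold M g" "i \<in> charts M"
  shows "local_metric (g i) (chart_img M i)"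
  using assms unfolding riemannian_manifold_def smooth_manifold_def riemannian_metric_def
  by unfold_locales blast+

lemma local_kaehler_chart:
  assumes "kaehler_manifold N g J" "i \<in> charts N"
  shows "local_kaehler (g i) (chart_img N i) (J i)"
proof -
  interpret local_metric "g i" "chart_img N i"
    using assms(1) unfolding kaehler_manifold_def by (intro local_metric_chart[OF _ assms(2)]) blast
  have "\<forall>x\<in>chart_img N i. linear (J i x) \<and> (\<forall>u. J i x (J i x u) = - u)"
    "\<forall>u. smooth_on (chart_img N i) (\<lambda>x. J i x u)"
    "\<forall>x\<in>chart_img N i. (\<forall>u v. g i x (J i x u) (J i x v) = g i x u v) \<and>
      (\<forall>X Y. smooth_on (chart_img N i) X \<and> smooth_on (chart_img N i) Y \<longrightarrow>
        cov (g i) X (\<lambda>y. J i y (Y y)) x = J i x (cov (g i) X Y x))"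
    using assms unfolding kaehler_manifold_def almost_complex_structure_def by metis+
  then show ?thesis
    by (intro local_kaehler.intro local_kaehler_axioms.intro local_metric_axioms) simp_all
qed

lemma param_prod_atlas:
  assumes i: "homeomorphism (chart_dom B i) (chart_img B i) (coord B i) (param B i)"
    and j: "homeomorphism (chart_dom F j) (chart_img F j) (coord F j) (param F j)"
    and p: "p \<in> chart_dom B i" and q: "q \<in> chart_dom F j"
  shows "param (prod_atlas B F) (i, j) (coord B i p, coord F j q) = (p, q)"
proof -
  have "inj_on (coord B i) (chart_dom B i)"
    by (rule inj_on_inverseI) (rule homeomorphism_apply1[OF i])
  moreover have "inj_on (coord F j) (chart_dom F j)"
    by (rule inj_on_inverseI) (rule homeomorphism_apply1[OF j])
  ultimately have "inj_on (map_prod (coord B i) (coord F j)) (chart_dom B i \<times> chart_dom F j)"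
    by (rule map_prod_inj_on)
  then show ?thesis
    using inv_into_f_f[of "map_prod (coord B i) (coord F j)" "chart_dom B i \<times> chart_dom F j" "(p, q)"] p q
    by (simp add: param_def prod_atlas_def)
qed

text \<open>The set is the preimage of \<open>Z\<close> under \<open>\<psi>\<close> read in the
  coordinates of the two factors. Openness is what allows Frechet derivatives and
  \<open>smooth_on\<close> to be used for the local representative of the immersion.\<close>

lemma open_domain_local_rep:
  assumes i: "homeomorphism (chart_dom B i) (chart_img B i) (coord B i) (param B i)" "open (chart_img B i)"
    and j: "homeomorphism (chart_dom F j) (chart_img F j) (coord F j) (param F j)" "open (chart_img F j)"
    and \<psi>: "continuous_on (chart_dom B i \<times> chart_dom F j) \<psi>" and Z: "open Z"
  shows "open (coord (prod_atlas B F) (i, j) ` {p \<in> chart_dom B i \<times> chart_dom F j. \<psi> p \<in> Z})"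
proof -
  let ?\<psi> = "\<lambda>z. \<psi> (param B i (fst z), param F j (snd z))"
  have cont: "continuous_on (chart_img B i \<times> chart_img F j) ?\<psi>"
  proof (rule continuous_on_compose2[OF \<psi>])
    show "continuous_on (chart_img B i \<times> chart_img F j) (\<lambda>z. (param B i (fst z), param F j (snd z)))"
      using i(1) j(1) unfolding homeomorphism_def
      by (intro continuous_on_Pair continuous_on_compose2[of _ "param B i" _ fst]
          continuous_on_compose2[of _ "param F j" _ snd] continuous_on_fst continuous_on_snd
          continuous_on_id) auto
  qed (use i(1) j(1) in \<open>auto simp: homeomorphism_def\<close>)
  have "coord (prod_atlas B F) (i, j) ` {p \<in> chart_dom B i \<times> chart_dom F j. \<psi> p \<in> Z}
      = (chart_img B i \<times> chart_img F j) \<inter> ?\<psi> -` Z" (is "?L = ?R")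
  proof
    show "?L \<subseteq> ?R"
      using homeomorphism_apply1[OF i(1)] homeomorphism_apply1[OF j(1)]
      by (auto simp: prod_atlas_def chart_img_def)
    show "?R \<subseteq> ?L"
    proof
      fix z assume z: "z \<in> ?R"
      have "param B i (fst z) \<in> chart_dom B i" "param F j (snd z) \<in> chart_dom F j"
        using z i(1) j(1) by (auto simp: homeomorphism_def)
      moreover have "z = coord (prod_atlas B F) (i, j) (param B i (fst z), param F j (snd z))"
        using z homeomorphism_apply2[OF i(1)] homeomorphism_apply2[OF j(1)]
        by (auto simp: prod_atlas_def)
      ultimately show "z \<in> ?L" using z by blast
    qed
  qed
  then show ?thesis
    using continuous_open_preimage[OF cont _ Z] i(2) j(2) by (simp add: open_Times)
qed

theorem corollary3p6:
  fixes B :: "('i, 'b::{t2_space,second_countable_topology}, 'eb::euclidean_space) atlas"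
    and F :: "('j, 'f::{t2_space,second_countable_topology}, 'ef::euclidean_space) atlas"
    and N :: "('k, 'n::{t2_space,second_countable_topology}, 'en::euclidean_space) atlas"
    and gB :: "'i \<Rightarrow> 'eb metric" and gF :: "'j \<Rightarrow> 'ef metric" and gN :: "'k \<Rightarrow> 'en metric"
    and J :: "'k \<Rightarrow> 'en \<Rightarrow> 'en \<Rightarrow> 'en"
    and f :: "'b \<Rightarrow> real" and \<psi> :: "'b \<times> 'f \<Rightarrow> 'n" and c :: real
  defines "M \<equiv> prod_atlas B F" and "g \<equiv> warped_metric B gB f gF"
  assumes "riemannian_manifold B gB" and "riemannian_manifold F gF"
    and "smooth_function B f" and "\<forall>b\<in>points B. f b > 0"
    and "complex_space_form N gN J c"
    and "isometric_immersion M g N gN \<psi>"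
    and "totally_geodesic M g N gN \<psi>"
    and "totally_real M N gN J \<psi>"
  shows "\<forall>(b, q)\<in>points M.
    real DIM('eb) * (c / 4) \<le> laplacian B gB f b / f b \<and>
    laplacian B gB f b / f b \<le> real DIM('eb) * (c / 4)"
proof -
  \<comment> \<open>The Laplacian involves \<open>b\<close> only; the fibre point \<open>q\<close>
    supplies the point of the product at which the immersion is examined.\<close>
  have laplacian_eq: "laplacian B gB f b = real DIM('eb) * (c / 4) * f b" and b_in: "b \<in> points B"
    if bq: "(b, q) \<in> points M" for b q
  proof -
    obtain i0 j where i0: "i0 \<in> charts B" "b \<in> chart_dom B i0" and j: "j \<in> charts F" "q \<in> chart_dom F j"
      using bq by (auto simp: M_def points_def prod_atlas_def)
    then show "b \<in> points B" by (auto simp: points_def)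
    have "\<psi> (b, q) \<in> points N"
      using assms(8) bq by (auto simp: isometric_immersion_def smooth_map_def)
    then obtain k where k: "k \<in> charts N" "\<psi> (b, q) \<in> chart_dom N k"
      by (auto simp: points_def)
    have mB: "smooth_manifold B" and mF: "smooth_manifold F" and N: "kaehler_manifold N gN J"
      using assms by (auto simp: riemannian_manifold_def complex_space_form_def)
    then have mN: "smooth_manifold N"
      by (simp add: kaehler_manifold_def riemannian_manifold_def)
    have homeo: "homeomorphism (chart_dom A i) (chart_img A i) (coord A i) (param A i)"
      "open (chart_img A i)" "open (chart_dom A i)"
      if "smooth_manifold A" "i \<in> charts A"
      for A :: "('x, 'y::{t2_space,second_countable_topology}, 'z::euclidean_space) atlas" and i
      using that by (auto simp: smooth_manifold_def)
    \<comment> \<open>The base chart \<open>i\<close>, the set \<open>T\<close> and the frame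
      \<open>E\<close> are arbitrary, so that whatever \<open>laplacian\<close> chooses is covered.
      The fibre chart \<open>j\<close> and the target chart \<open>k\<close> stay fixed.\<close>
    have frame: "frame_laplacian (gB i) E (f \<circ> param B i) (coord B i b) = real DIM('eb) * (c / 4) * f b"
      if i: "i \<in> charts B" "b \<in> chart_dom B i" and
        T: "open T" "coord B i b \<in> T" "T \<subseteq> chart_img B i" "orthonormal_frame_on (gB i) T E"
      for i T E
    proof -
      note hB = homeo[OF mB i(1)] and hF = homeo[OF mF j(1)] and hN = homeo[OF mN k(1)]
      interpret LB: local_metric "gB i" "chart_img B i"
        by (rule local_metric_chart[OF assms(3) i(1)])
      interpret LF: local_metric "gF j" "chart_img F j"
        by (rule local_metric_chart[OF assms(4) j(1)])
      have fs: "smooth_on (chart_img B i) (f \<circ> param B i)"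
        using assms(5) i(1) by (simp add: smooth_function_def)
      have fpos: "(f \<circ> param B i) x > 0" if "x \<in> chart_img B i" for x
      proof -
        have "param B i x \<in> chart_dom B i"
          using homeomorphism_image2[OF hB(1)] that by blast
        then show ?thesis
          using assms(6) i(1) by (auto simp: points_def)
      qed
      interpret W: local_warped "gB i" "chart_img B i" "gF j" "chart_img F j" "f \<circ> param B i"
        by unfold_locales (use fs fpos in auto)
      have gW: "W.gW = g (i, j)"
        by (intro ext) (simp add: W.gW_def g_def warped_metric_def case_prod_beta)
      have ij: "(i, j) \<in> charts M" and dom: "chart_dom M (i, j) = chart_dom B i \<times> chart_dom F j"
        using i j by (auto simp: M_def prod_atlas_def)
      \<comment> \<open>Coordinates of the points that \<open>\<psi>\<close> sends into chart
        \<open>k\<close>: for this pair of charts, the hypotheses on the immersion speak about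
        \<open>h\<close> only there.\<close>
      define V where "V = coord M (i, j) ` {p \<in> chart_dom M (i, j). \<psi> p \<in> chart_dom N k}"
      define h where "h = local_rep M (i, j) N k \<psi>"
      have fb: "f (param B i (coord B i b)) = f b"
        using homeomorphism_apply1[OF hB(1) i(2)] by simp
      have hess: "D (f \<circ> param B i) (coord B i b) (christoffel (gB i) (coord B i b) a a)
          - D (\<lambda>y. D (f \<circ> param B i) y a) (coord B i b) a
          = c / 4 * (f \<circ> param B i) (coord B i b) * gB i (coord B i b) a a" for a
      proof (rule W.hessian_eq[OF local_kaehler_chart[OF N k(1)], where h = h and W = V and y = "coord F j q"])
        have sub: "chart_dom B i \<times> chart_dom F j \<subseteq> points M"
          using dom ij by (auto simp: points_def)
        have \<psi>: "smooth_map M N \<psi>"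
          using assms(8) by (simp add: isometric_immersion_def)
        then have "continuous_on (chart_dom B i \<times> chart_dom F j) \<psi>"
          unfolding smooth_map_def by (elim conjE) (rule continuous_on_subset[OF _ sub])
        from open_domain_local_rep[OF hB(1,2) hF(1,2) this hN(3)]
        show "open V" by (simp add: V_def M_def[symmetric] dom)
        show "smooth_on V h"
          using \<psi> ij k(1) unfolding smooth_map_def V_def h_def by blast
        have bq_dom: "(b, q) \<in> chart_dom M (i, j)"
          using i j by (simp add: dom)
        have coord_bq: "coord M (i, j) (b, q) = (coord B i b, coord F j q)"
          by (simp add: M_def prod_atlas_def)
        show "(coord B i b, coord F j q) \<in> V"
          unfolding V_def using bq_dom coord_bq k(2) by (intro image_eqI[of _ _ "(b, q)"]) auto
        show "V \<subseteq> chart_img B i \<times> chart_img F j"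
          by (auto simp: V_def dom chart_img_def M_def prod_atlas_def)
        have h_coord: "h (coord M (i, j) p) = coord N k (\<psi> p)" if "p \<in> chart_dom M (i, j)" for p
          using that param_prod_atlas[OF hB(1) hF(1), of "fst p" "snd p"]
          by (cases p) (auto simp: h_def local_rep_def M_def prod_atlas_def)
        show "h ` V \<subseteq> chart_img N k"
          by (auto simp: V_def h_coord chart_img_def)
        show "sectional_curvature (gN k) z u (J k z u) = c" if "z \<in> chart_img N k" "u \<noteq> 0" for z u
          using assms(7) k(1) that by (simp add: complex_space_form_def)
        show "gN k (h (coord B i b, coord F j q)) (D h (coord B i b, coord F j q) u)
            (D h (coord B i b, coord F j q) v) = W.gW (coord B i b, coord F j q) u v" for u v
          using assms(8) ij k bq_dom coord_bq
          by (cases u; cases v) (auto simp: isometric_immersion_def h_def gW Let_def dest!: bspec)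
        show "gN k (h (coord B i b, coord F j q)) (J k (h (coord B i b, coord F j q))
            (D h (coord B i b, coord F j q) u)) (D h (coord B i b, coord F j q) v) = 0" for u v
          using assms(10) ij k bq_dom coord_bq
          by (cases u; cases v) (auto simp: totally_real_def h_def Let_def dest!: bspec)
        show "cov_along (gN k) h (\<lambda>_. u) (\<lambda>y. D h y v) z = D h z (christoffel W.gW z u v)"
          if z: "z \<in> V" for z u v
        proof -
          obtain p where p: "p \<in> chart_dom M (i, j)" "\<psi> p \<in> chart_dom N k" "z = coord M (i, j) p"
            using z by (auto simp: V_def)
          \<comment> \<open>For constant coefficients \<open>cov\<close> reduces to the Christoffel
            term, so the vanishing Gauss difference is the identity wanted.\<close>
          have "second_fundamental_form M g N gN \<psi> (i, j) k p u v = 0"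
            using assms(9) ij k(1) p unfolding totally_geodesic_def by blast
          then show ?thesis
            using p(3) by (simp add: second_fundamental_form_def Let_def h_def gW cov_def)
        qed
      qed
      have "frame_laplacian (gB i) E (f \<circ> param B i) (coord B i b)
          = real DIM('eb) * (c / 4 * (f \<circ> param B i) (coord B i b))"
        by (rule LB.frame_laplacian_eq[OF T(4,1,3,2) fs hess])
      then show ?thesis by (simp add: fb)
    qed
    show "laplacian B gB f b = real DIM('eb) * (c / 4) * f b"
      unfolding laplacian_def
    \<comment> \<open>A frame on the whole of chart \<open>i0\<close> shows that a value exists to
      be chosen; \<open>frame\<close> shows that every admissible value is the right one.\<close>
    proof (rule someI2_ex)
      interpret LB: local_metric "gB i0" "chart_img B i0"
        by (rule local_metric_chart[OF assms(3) i0(1)])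
      obtain E where "orthonormal_frame_on (gB i0) (chart_img B i0) E"
        using LB.orthonormal_frame_exists by blast
      moreover have "coord B i0 b \<in> chart_img B i0"
        using i0(2) by (simp add: chart_img_def)
      ultimately show "\<exists>L. \<exists>i\<in>charts B. b \<in> chart_dom B i \<and>
        (\<exists>S v. open S \<and> coord B i b \<in> S \<and> S \<subseteq> chart_img B i \<and> orthonormal_frame_on (gB i) S v \<and>
          L = frame_laplacian (gB i) v (f \<circ> param B i) (coord B i b))"
        using i0 LB.open_S by blast
    qed (use frame in blast)
  qed
  show ?thesis
  proof (clarify, goal_cases)
    case (1 b q)
    then have "f b > 0"
      using assms(6) b_in[OF 1] by blast
    then show ?case
      by (simp add: laplacian_eq[OF 1])
  qed
qed

end
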